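(* For $n\ge0$ define $\Phi,\ \mathrm F_3:\mathfrak S_n\to\mathfrak S_n$ by $\Phi(\sigma)=\mathrm{ZDer}^{-1}({\bf\Phi}(\mathrm{ZDer}(\sigma)))$ and $\mathrm F_3(\sigma)=\mathrm{ZDer}^{-1}({\bf F}_3(\mathrm{ZDer}(\sigma)))$. Then $\Phi$ and $\mathrm F_3$ are bijections of $\mathfrak S_n$ onto itself, and for every $\sigma\in\mathfrak S_n$: $$(\mathrm{fix},\mathrm{RIZE},\mathrm{Der})\,\sigma=(\mathrm{fix},\mathrm{RISE},\mathrm{Der})\,\Phi(\sigma);$$ $$(\mathrm{fix},\mathrm{maz},\mathrm{Der})\,\sigma=(\mathrm{fix},\mathrm{maf},\mathrm{Der})\,\mathrm F_3(\sigma);$$ $$(\mathrm{fix},\mathrm{maj},\mathrm{Der})\,\sigma=(\mathrm{fix},\mathrm{maf},\mathrm{Der})\,\mathrm F_3\circ\Phi^{-1}(\sigma).$$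
   Context: Words have nonnegative integer letters. For $w=x_1\cdots x_n$: $\mathrm{DES}\,w=\{i:1\le i\le n-1,\ x_i>x_{i+1}\}$, $\mathrm{maj}\,w=\sum_{i\in\mathrm{DES}\,w}i$, $\mathrm{RISE}\,w=\{i:1\le i\le n,\ x_i\le x_{i+1}\}$ with $x_{n+1}=+\infty$; $\mathrm{Zero}\,w=\{i:x_i=0\}$, $\mathrm{zero}\,w=\#\mathrm{Zero}\,w$; $\mathrm{Pos}\,w$ is the subword of positive letters; $\mathrm{mafz}\,w=\sum_{i\in\mathrm{Zero}\,w}i-\sum_{i=1}^{\mathrm{zero}\,w}i+\mathrm{maj}\,\mathrm{Pos}\,w$. $\mathrm{Sh}(0^{n-m}v)$ is the set of words of length $n$ with $n-m$ zeros and positive-letter subword $v$. A derangement of order $m$ is a permutation word $y_1\cdots y_m$ of $1,\dots,m$ with $y_i\neq i$ for all $i$. Permutations are words $\sigma(1)\cdots\sigma(n)$; $\mathrm{RISE}\,\sigma$, $\mathrm{DES}\,\sigma$, $\mathrm{maj}\,\sigma$ are as for words (with $\sigma(n+1)=+\infty$); $\mathrm{fix}\,\sigma$ is the number of fixed points. $\mathrm{ZDer}$: for $\sigma\in\mathfrak S_n$ let $j_1<\cdots<j_m$ be the non-fixed points, $\mathrm{red}$ the increasing bijection of $\{j_1,\dots,j_m\}$ onto $\{1,\dots,m\}$; $\mathrm{ZDer}(\sigma)=x_1\cdots x_n$ with $x_i=0$ if $\sigma(i)=i$, $x_i=\mathrm{red}(\sigma(i))$ otherwise. It is a bijection from $\mathfrak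 S_n$ onto the union of the classes $\mathrm{Sh}(0^{n-m}v)$, $0\le m\le n$, $v$ a derangement of order $m$. $\mathrm{Der}\,\sigma=\mathrm{Pos}\,\mathrm{ZDer}(\sigma)$ (a derangement of order $m$). $\mathrm{RIZE}\,\sigma=\mathrm{RISE}\,\mathrm{ZDer}(\sigma)$, $\mathrm{maz}\,\sigma=\mathrm{maj}\,\mathrm{ZDer}(\sigma)$, $\mathrm{maf}\,\sigma=\mathrm{mafz}\,\mathrm{ZDer}(\sigma)$. The map ${\bf\Phi}$ on $\mathrm{Sh}(0^{n-m}v)$, $v$ a derangement of order $m$: for $w=x_1\cdots x_n$ and a position $k$ with $x_k>0$, $\mathrm{red}(k)$ is the number of positive letters among $x_1,\dots,x_k$; $x_k$ is excedent if $x_k>\mathrm{red}(k)$, subexcedent if $x_k<\mathrm{red}(k)$; non-subexcedent means $0$ or excedent; $x_0=x_{n+1}=+\infty$ are regarded as non-subexcedent. For $1\le l\le n$: if $l>n-m$, $\phi_l(w)=w$; otherwise let $j$ be the position of the $l$-th zero of $w$ from the left. (a) If $x_{j-1},x_{j+1}$ are both non-subexcedent, $\phi_l(w)=w$. (b) If $x_{j-1}$ is non-subexcedent and $x_{j+1}$ subexcedent, or both are subexcedent with $x_{j-1}>x_{j+1}$: with $k$ the greatest integer $\ge j+1$ such that $x_{j+1}<\cdots<x_k<\mathrm{red}(k)$, $\phi_l(w)=x_1\cdots x_{j-1}x_{j+1}\cdots x_k\,0\,x_{k+1}\cdots x_n$. (c) If $x_{j-1}$ is subexcedent and $x_{j+1}$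 non-subexcedent, or both are subexcedent with $x_{j-1}<x_{j+1}$: with $i$ the smallest integer $\le j-1$ such that $\mathrm{red}(i)>x_i>\cdots>x_{j-1}$, $\phi_l(w)=x_1\cdots x_{i-1}\,0\,x_i\cdots x_{j-1}x_{j+1}\cdots x_n$. Then ${\bf\Phi}=\phi_1\circ\phi_2\circ\cdots\circ\phi_n$. The map ${\bf F}_3$ on words, by induction on length $n$: if $n\le1$ or all letters except the last are $0$, ${\bf F}_3(w)=w$. Otherwise write uniquely $w=w'a0^rb$ with $a\ge1$ the rightmost positive letter among the first $n-1$ letters, $r\ge0$, $b\ge0$ the last letter. (1) $a\le b$: ${\bf F}_3(w)={\bf F}_3(w'a0^r)b$. (2) $a>b$, $r\ge1$: writing ${\bf F}_3(w'a0^r)=w''c$ with $c$ a letter, ${\bf F}_3(w)=0w''b$. (3) $a>b$, $r=0$: writing ${\bf F}_3(w'a)=0^{m_1}x_1v_1\cdots0^{m_k}x_kv_k$ ($m_1\ge0$, $m_2,\dots,m_k\ge1$, $x_i$ positive letters, $v_i$ possibly empty words of positive letters), ${\bf F}_3(w)=x_10^{m_1}v_1x_20^{m_2}v_2\cdots x_k0^{m_k}v_k\,b$. *)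

theory Defs
  imports Main "HOL-Combinatorics.Multiset_Permutations"
begin

(* Words are lists of naturals w = x_1 ... x_n; letter x_i is  w ! (i - 1).
   Positions are 1-based as in the paper. *)

definition DES :: "nat list \<Rightarrow> nat set" where
  "DES w = {i. 1 \<le> i \<and> i \<le> length w - 1 \<and> w ! (i - 1) > w ! i}"

definition maj :: "nat list \<Rightarrow> nat" where
  "maj w = \<Sum> (DES w)"

(* x_{n+1} = +infinity *)
definition RISE :: "nat list \<Rightarrow> nat set" where
  "RISE w = {i. 1 \<le> i \<and> i \<le> length w \<and> (i = length w \<or> w ! (i - 1) \<le> w ! i)}"

definition Zero :: "nat list \<Rightarrow> nat set" where
  "Zero w = {i. 1 \<le> i \<and> i \<le> length w \<and> w ! (i - 1) = 0}"

definition zero :: "nat list \<Rightarrow> nat" where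
  "zero w = card (Zero w)"

definition Pos :: "nat list \<Rightarrow> nat list" where
  "Pos w = filter (\<lambda>x. 0 < x) w"

(* computed in int to avoid any truncation; the value is always nonnegative *)
definition mafz :: "nat list \<Rightarrow> int" where
  "mafz w = int (\<Sum> (Zero w)) - int (\<Sum> {1..zero w}) + int (maj (Pos w))"

abbreviation Sn :: "nat \<Rightarrow> nat list set" where
  "Sn n \<equiv> permutations_of_set {1..n}"

definition fixpts :: "nat list \<Rightarrow> nat" where
  "fixpts s = card {i. 1 \<le> i \<and> i \<le> length s \<and> s ! (i - 1) = i}"

(* red: increasing bijection of the non-fixed points onto {1..m} *)
definition redP :: "nat list \<Rightarrow> nat \<Rightarrow> nat" where
  "redP s j = card {k. 1 \<le> k \<and> k \<le> length s \<and> s ! (k - 1) \<noteq> k \<and> k \<le> j}"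

definition ZDer :: "nat list \<Rightarrow> nat list" where
  "ZDer s = map (\<lambda>i. if s ! (i - 1) = i then 0 else redP s (s ! (i - 1))) [1..<length s + 1]"

definition Der :: "nat list \<Rightarrow> nat list" where
  "Der s = Pos (ZDer s)"

definition RIZE :: "nat list \<Rightarrow> nat set" where
  "RIZE s = RISE (ZDer s)"

definition maz :: "nat list \<Rightarrow> nat" where
  "maz s = maj (ZDer s)"

definition maf :: "nat list \<Rightarrow> int" where
  "maf s = mafz (ZDer s)"

definition redW :: "nat list \<Rightarrow> nat \<Rightarrow> nat" where
  "redW w k = length (filter (\<lambda>x. 0 < x) (take k w))"

(* subexcedent letter at position k (positions 0 and n+1 are never subexcedent) *)
definition subexc :: "nat list \<Rightarrow> nat \<Rightarrow> bool" where
  "subexc w k = (1 \<le> k \<and> k \<le> length w \<and> 0 < w ! (k - 1) \<and> w ! (k - 1) < redW w k)"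

definition zeropos :: "nat list \<Rightarrow> nat \<Rightarrow> nat" where
  "zeropos w l = filter (\<lambda>i. w ! (i - 1) = 0) [1..<length w + 1] ! (l - 1)"

definition phi :: "nat \<Rightarrow> nat list \<Rightarrow> nat list" where
  "phi l w =
    (let n = length w; m = length (Pos w) in
     if l < 1 \<or> l > n - m then w else
     let j = zeropos w l; x = (\<lambda>i. w ! (i - 1)) in
     if \<not> subexc w (j - 1) \<and> \<not> subexc w (j + 1) then w
     else if (\<not> subexc w (j - 1) \<and> subexc w (j + 1)) \<or>
             (subexc w (j - 1) \<and> subexc w (j + 1) \<and> x (j - 1) > x (j + 1)) then
       (let k = (GREATEST k. j + 1 \<le> k \<and> k \<le> n \<and>
                   (\<forall>t. j + 1 \<le> t \<and> t < k \<longrightarrow> x t < x (t + 1)) \<and> x k < redW w k)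
        in take (j - 1) w @ take (k - j) (drop j w) @ [0] @ drop k w)
     else if (subexc w (j - 1) \<and> \<not> subexc w (j + 1)) \<or>
             (subexc w (j - 1) \<and> subexc w (j + 1) \<and> x (j - 1) < x (j + 1)) then
       (let i = (LEAST i. 1 \<le> i \<and> i \<le> j - 1 \<and> x i < redW w i \<and>
                   (\<forall>t. i \<le> t \<and> t < j - 1 \<longrightarrow> x t > x (t + 1)))
        in take (i - 1) w @ [0] @ take (j - i) (drop (i - 1) w) @ drop j w)
     else w)"

definition bPhi :: "nat list \<Rightarrow> nat list" where
  "bPhi w = foldr phi [1..<length w + 1] w"

(* 0^{m1} x1 v1 ... 0^{mk} xk vk  |->  x1 0^{m1} v1 ... xk 0^{mk} vk ;
   first argument accumulates the current run of zeros *)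
fun swapz :: "nat list \<Rightarrow> nat list \<Rightarrow> nat list" where
  "swapz zs [] = zs"
| "swapz zs (x # xs) =
     (if x = 0 then swapz (zs @ [0]) xs else x # zs @ swapz [] xs)"

function bF3 :: "nat list \<Rightarrow> nat list" where
  "bF3 w =
    (if length w \<le> 1 \<or> (\<forall>y\<in>set (butlast w). y = 0) then w else
     let u = butlast w; b = last w;
         r = length (takeWhile (\<lambda>y. y = 0) (rev u));
         a = u ! (length u - r - 1) in
     if a \<le> b then bF3 u @ [b]
     else if 1 \<le> r then 0 # butlast (bF3 u) @ [b]
     else swapz [] (bF3 u) @ [b])"
  by pat_completeness auto
termination
  by (relation "measure length") auto

definition PhiS :: "nat \<Rightarrow> nat list \<Rightarrow> nat list" where
  "PhiS n s = the_inv_into (Sn n) ZDer (bPhi (ZDer s))"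

definition F3S :: "nat \<Rightarrow> nat list \<Rightarrow> nat list" where
  "F3S n s = the_inv_into (Sn n) ZDer (bF3 (ZDer s))"

end

theory Submission
  imports Defs
begin

text \<open>
  For \<open>\<Phi>\<close>: the rises of a permutation are the rises of its word \<open>ZDer\<close> once each zero is given a value
  between the subexcedent and the excedent letters next to it, instead of the smallest value. The
  map \<open>\<phi>\<^sub>l\<close> moves the \<open>l\<close>-th zero so that changing its value from ``smallest'' to ``in between''
  does not alter the rise set; applying \<open>\<phi>\<^sub>n, \<dots>, \<phi>\<^sub>1\<close> converts the zeros from right to left. Each
  \<open>\<phi>\<^sub>l\<close> is injective because the rise set determines where a smallest letter was inserted: moving it
  over a nonempty block of larger letters changes the number of rises inside the block.

  For \<open>F\<^sub>3\<close>: \<open>mafz w\<close> is \<open>maj (Pos w)\<close> plus the number of pairs (positive letter, zero to its right), and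
  appending a letter changes \<open>maj\<close> and this count of the image by the same amount. Injectivity holds
  because \<open>F\<^sub>3\<close> preserves the last letter and the positive subword, and its first letter tells
  cases (2) and (3) apart.
\<close>

subsection \<open>Rises of words with reinterpreted zeros\<close>

text \<open>Unlike the set \<open>RISE\<close>, a Boolean list splits along concatenation without
  shifting positions. The last position, a rise by the convention at infinity, is left out.\<close>

fun adj :: "nat list \<Rightarrow> bool list" where
  "adj (x # y # ys) = (x \<le> y) # adj (y # ys)"
| "adj _ = []"

lemma length_adj [simp]: "length (adj xs) = length xs - 1"
  by (induction xs rule: adj.induct) auto

lemma nth_adj: "Suc i < length xs \<Longrightarrow> adj xs ! i = (xs ! i \<le> xs ! Suc i)"
proof (induction xs arbitrary: i rule: adj.induct)
  case (1 x y ys)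
  then show ?case by (cases i) auto
qed auto

lemma adj_append:
  "xs \<noteq> [] \<Longrightarrow> ys \<noteq> [] \<Longrightarrow> adj (xs @ ys) = adj xs @ (last xs \<le> hd ys) # adj ys"
proof (induction xs rule: adj.induct)
  case ("2_2" v)
  then show ?case by (cases ys) auto
qed auto

text \<open>The pattern of a concatenation consists of the inner patterns and the comparisons at the
  joints. For \<open>phi\<close>, \<open>X\<close> and \<open>Y\<close> are the zero with its
  crossed block (possibly empty) before and after the move.\<close>

lemma adj_replace:
  assumes "X \<noteq> []" "Y \<noteq> []" "adj X = adj Y"
    and "P \<noteq> [] \<Longrightarrow> (last P \<le> hd X) = (last P \<le> hd Y)"
    and "Q \<noteq> [] \<Longrightarrow> (last X \<le> hd Q) = (last Y \<le> hd Q)"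
  shows "adj (P @ X @ Q) = adj (P @ Y @ Q)"
  using assms by (cases "P = []"; cases "Q = []") (auto simp: adj_append)

text \<open>In front of \<open>T\<close> a smallest letter adds a rise to the pattern of
  \<open>T\<close>, behind \<open>T\<close> it adds a descent. This is what makes the moves of
  \<open>phi\<close> reversible.\<close>

lemma adj_insert_zero_neq:
  assumes "T \<noteq> []" "last T > 0"
  shows "adj (S @ 0 # T @ U) \<noteq> adj (S @ T @ 0 # U)"
proof
  assume eq: "adj (S @ 0 # T @ U) = adj (S @ T @ 0 # U)"
  \<comment> \<open>Cuts the window of \<open>X\<close> out of the whole pattern: if
    \<open>S\<close> is nonempty, \<open>length S - 1\<close> comparisons inside \<open>S\<close>
    and one at the joint precede it.\<close>
  have *: "take (length X - 1) (drop (length S) (adj (S @ X @ U))) = adj X" if "X \<noteq> []" for X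
  proof (cases "S = []")
    case False
    then have "length S - (length S - Suc 0) = Suc 0" by (cases S) auto
    with False that show ?thesis by (cases "U = []") (auto simp: adj_append)
  qed (use that in \<open>cases "U = []"; auto simp: adj_append\<close>)
  have "adj (0 # T) = adj (T @ [0])"
    using *[of "0 # T"] *[of "T @ [0]"] eq by simp
  moreover have "adj (0 # T) = True # adj T"
    using assms by (cases T) auto
  moreover have "adj (T @ [0]) = adj T @ [False]"
    using assms by (auto simp: adj_append)
  \<comment> \<open>The two sides contain different numbers of rises.\<close>
  ultimately have "count_list (True # adj T) True = count_list (adj T @ [False]) True" by simp
  then show False by simp
qed

lemma RISE_adj: "RISE w = {i. 1 \<le> i \<and> i \<le> length w \<and> (i = length w \<or> adj w ! (i - 1))}"
proof -
  have "adj w ! (i - 1) = (w ! (i - 1) \<le> w ! i)" if "1 \<le> i" "i < length w" for i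
    using that nth_adj[of "i - 1" w] by simp
  then show ?thesis unfolding RISE_def by (intro Collect_cong) (auto simp: le_less)
qed

lemma RISE_eq: "length w = length w' \<Longrightarrow> adj w = adj w' \<Longrightarrow> RISE w = RISE w'"
  by (simp add: RISE_adj)

lemma Pos_append [simp]: "Pos (xs @ ys) = Pos xs @ Pos ys"
  and Pos_Nil [simp]: "Pos [] = []"
  and Pos_Cons [simp]: "Pos (x # xs) = (if x = 0 then Pos xs else x # Pos xs)"
  by (auto simp: Pos_def)

lemma length_eq_zeros_Pos: "length w = count_list w 0 + length (Pos w)"
  by (induction w) auto

lemma Pos_id: "0 \<notin> set xs \<Longrightarrow> Pos xs = xs"
  by (induction xs) auto

text \<open>The first \<open>k\<close> zeros are smaller than every positive letter; each later zero lies strictly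
  between the subexcedent and the excedent letters next to it, \<open>r\<close> being the number of positive
  letters already read. Ordinary rises of \<open>key k 0 w\<close> thus interpolate between the rises of \<open>w\<close>
  (\<open>k\<close> large) and those of the permutation encoded by \<open>w\<close> (\<open>k = 0\<close>).\<close>
fun key :: "nat \<Rightarrow> nat \<Rightarrow> nat list \<Rightarrow> nat list" where
  "key k r [] = []"
| "key k r (x # xs) =
    (if x > 0 then 2 * x # key k (Suc r) xs
     else (if k > 0 then 0 else 2 * r + 1) # key (k - 1) r xs)"

lemma length_key [simp]: "length (key k r w) = length w"
  by (induction k r w rule: key.induct) auto

lemma key_eq_Nil [simp]: "key k r w = [] \<longleftrightarrow> w = []"
  by (cases w) auto

lemma key_append:
  "key k r (xs @ ys) = key k r xs @ key (k - count_list xs 0) (r + length (Pos xs)) ys"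
proof (induction k r xs rule: key.induct)
  case (2 k r x xs)
  then show ?case by (cases k) auto
qed auto

lemma key_pos: "0 \<notin> set xs \<Longrightarrow> key k r xs = map ((*) 2) xs"
  by (induction xs arbitrary: r) auto

lemma key_all: "count_list xs 0 \<le> k \<Longrightarrow> key k r xs = map ((*) 2) xs"
  by (induction k r xs rule: key.induct) (auto split: if_splits)

lemma hd_key: "ys \<noteq> [] \<Longrightarrow> hd (key 0 r ys) = (if hd ys = 0 then 2 * r + 1 else 2 * hd ys)"
  by (cases ys) auto

lemma key_nth:
  "i < length w \<Longrightarrow> key 0 r w ! i = (if w ! i = 0 then 2 * (r + length (Pos (take i w))) + 1 else 2 * w ! i)"
proof (induction w arbitrary: i r)
  case (Cons x w)
  then show ?case by (cases i) auto
qed simp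

text \<open>Half of the notion of a derangement; the other half, that the letters are
  \<open>{1..m}\<close>, is added in \<open>derclass\<close>.\<close>

definition derword :: "nat list \<Rightarrow> bool" where
  "derword v \<longleftrightarrow> distinct v \<and> (\<forall>i<length v. v ! i \<noteq> Suc i)"

lemma zeropos_split:
  assumes "w = A @ 0 # B" "l = Suc (count_list A 0)"
  shows "zeropos w l = Suc (length A)"
proof -
  have 1: "[1..<length w + 1] = [1..<Suc (length A)] @ Suc (length A) # [Suc (Suc (length A))..<Suc (length w)]"
    using assms upt_add_eq_append[of 1 "Suc (length A)" "Suc (length B)"]
    by (simp add: upt_conv_Cons del: upt_Suc)
  have "length (filter (\<lambda>i. (A @ C) ! (i - 1) = 0) [1..<Suc (length A)]) = count_list A 0" for C
  proof (induction A arbitrary: C rule: rev_induct)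
    case (snoc x A)
    from snoc[of "x # C"] show ?case by simp
  qed simp
  from this[of "0 # B"] show ?thesis
    unfolding zeropos_def 1 using assms by (simp add: nth_append)
qed

text \<open>The letter \<open>x\<close> has place \<open>Suc (length (Pos A))\<close> in the
  positive subword. Hence every positive letter is either excedent or subexcedent, and no positive
  letter occurs twice.\<close>

lemma derword_split:
  assumes "derword (Pos (A @ x # B))" "x > 0"
  shows "x \<noteq> Suc (length (Pos A))" "x \<notin> set A" "x \<notin> set B"
proof -
  have "Pos (A @ x # B) ! length (Pos A) = x" using assms by simp
  moreover have "length (Pos A) < length (Pos (A @ x # B))" using assms by simp
  ultimately show "x \<noteq> Suc (length (Pos A))" using assms unfolding derword_def by metis
  show "x \<notin> set A" "x \<notin> set B" using assms by (auto simp: derword_def Pos_def split: if_splits)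
qed

subsection \<open>The map \<open>F\<^sub>3\<close>\<close>

text \<open>The argument \<open>r\<close> is the number of positive letters already read, so each
  zero contributes the number of positive letters to its left.\<close>

fun zinv :: "nat \<Rightarrow> nat list \<Rightarrow> nat" where
  "zinv r [] = 0"
| "zinv r (x # xs) = (if x = 0 then r + zinv r xs else zinv (Suc r) xs)"

lemma zinv_append: "zinv r (xs @ ys) = zinv r xs + zinv (r + length (Pos xs)) ys"
  by (induction r xs rule: zinv.induct) auto

lemma zinv_replicate: "zinv r (replicate k 0) = r * k"
  by (induction k) auto

section \<open>Major index and \<open>mafz\<close> under appending a letter\<close>

lemma DES_snoc: "DES (w @ [b]) = DES w \<union> (if w \<noteq> [] \<and> b < last w then {length w} else {})"
proof -
  have "i \<in> DES (w @ [b]) \<longleftrightarrow> i \<in> DES w \<or> (w \<noteq> [] \<and> b < last w \<and> i = length w)" for i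
  proof (cases "i < length w")
    case True
    then show ?thesis by (auto simp: DES_def nth_append)
  next
    case False
    then show ?thesis by (cases w rule: rev_cases) (auto simp: DES_def nth_append)
  qed
  note * = this
  show ?thesis by (rule set_eqI, subst *) auto
qed

lemma finite_DES: "finite (DES w)"
  by (rule finite_subset[of _ "{..length w}"]) (auto simp: DES_def)

lemma maj_snoc: "maj (w @ [b]) = maj w + (if w \<noteq> [] \<and> b < last w then length w else 0)"
proof -
  have "length w \<notin> DES w" by (cases w) (auto simp: DES_def)
  then show ?thesis by (simp add: maj_def DES_snoc finite_DES)
qed

lemma maj_Nil [simp]: "maj [] = 0" by (simp add: maj_def DES_def)

lemma Zero_snoc: "Zero (w @ [b]) = Zero w \<union> (if b = 0 then {Suc (length w)} else {})"
proof -
  have "i \<in> Zero (w @ [b]) \<longleftrightarrow> i \<in> Zero w \<or> (b = 0 \<and> i = Suc (length w))" for i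
    by (cases "i = Suc (length w)") (auto simp: Zero_def nth_append)
  note * = this
  show ?thesis by (rule set_eqI, subst *) auto
qed

lemma finite_Zero: "finite (Zero w)"
  by (rule finite_subset[of _ "{..length w}"]) (auto simp: Zero_def)

lemma Zero_fresh: "Suc (length w) \<notin> Zero w"
  by (auto simp: Zero_def)

lemma zero_eq_count: "zero w = count_list w 0"
proof (induction w rule: rev_induct)
  case Nil
  show ?case by (simp add: zero_def Zero_def)
next
  case (snoc x w)
  then show ?case by (simp add: zero_def Zero_snoc finite_Zero Zero_fresh)
qed

text \<open>The \<open>l\<close>-th zero, at position \<open>p\<close>, has \<open>p - l\<close>
  positive letters to its left; summing over all zeros gives the difference of the two sums in
  \<open>mafz\<close>.\<close>

lemma mafz_eq_zinv: "mafz w = int (zinv 0 w + maj (Pos w))"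
proof -
  have "int (\<Sum> (Zero w)) - int (\<Sum> {1..zero w}) = int (zinv 0 w)"
  proof (induction w rule: rev_induct)
    case Nil
    show ?case by (simp add: zero_def Zero_def)
  next
    case (snoc x w)
    have "\<Sum> (Zero (w @ [x])) = \<Sum> (Zero w) + (if x = 0 then Suc (length w) else 0)"
      by (simp add: Zero_snoc finite_Zero Zero_fresh)
    with snoc length_eq_zeros_Pos[of w] show ?case
      by (simp add: zero_eq_count zinv_append)
  qed
  then show ?thesis by (simp add: mafz_def)
qed

section \<open>The block swap of case (3) and its inverse\<close>

lemma length_swapz: "length (swapz zs xs) = length zs + length xs"
  by (induction zs xs rule: swapz.induct) auto

lemma Pos_swapz: "Pos (swapz (replicate k 0) xs) = Pos xs"
proof (induction xs arbitrary: k)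
  case (Cons x xs)
  from Cons[of 0] Cons[of "Suc k"] show ?case
    by (auto simp: Pos_def replicate_append_same)
qed (simp add: Pos_def)

text \<open>Since the word ends in a positive letter, every zero is overtaken by exactly one
  positive letter and gains one. The \<open>k\<close> pending zeros thus count \<open>Suc r\<close>
  each.\<close>

lemma zinv_swapz:
  "xs \<noteq> [] \<Longrightarrow> last xs > 0 \<Longrightarrow>
    zinv r (swapz (replicate k 0) xs) = Suc r * k + zinv r xs + count_list xs 0"
proof (induction xs arbitrary: k r)
  case (Cons x xs)
  have 0: "Pos (replicate k 0) = []" by (simp add: Pos_def)
  show ?case
  proof (cases "x = 0")
    case True
    with Cons.prems have "xs \<noteq> []" by auto
    with Cons.IH[of r "Suc k"] Cons.prems True show ?thesis by (simp add: replicate_append_same)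
  next
    case False
    with Cons.IH[of "Suc r" 0] Cons.prems show ?thesis
      by (cases "xs = []") (auto simp: zinv_append zinv_replicate 0)
  qed
qed simp

text \<open>Inverse of the swap on words with positive first letter: each positive letter jumps back
  over the run of zeros directly behind it.\<close>

function unswapz :: "nat list \<Rightarrow> nat list" where
  "unswapz [] = []"
| "unswapz (x # xs) = takeWhile (\<lambda>y. y = 0) xs @ x # unswapz (dropWhile (\<lambda>y. y = 0) xs)"
  by pat_completeness auto
termination
  by (relation "measure length") (auto simp: less_Suc_eq_le length_dropWhile_le)

text \<open>The first positive letter jumps in front of all zeros before it. This separates case (3)
  from case (2), whose image begins with zero, and delimits the runs read by
  \<open>unswapz\<close>.\<close>

lemma hd_swapz: "xs \<noteq> [] \<Longrightarrow> last xs > 0 \<Longrightarrow> swapz (replicate k 0) xs \<noteq> [] \<and> hd (swapz (replicate k 0) xs) > 0"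
proof (induction xs arbitrary: k)
  case (Cons x xs)
  from Cons.IH[of "Suc k"] Cons.prems show ?case
    by (cases "xs = []") (auto simp: replicate_append_same)
qed simp

lemma unswapz_swapz:
  "xs \<noteq> [] \<Longrightarrow> last xs > 0 \<Longrightarrow> unswapz (swapz (replicate k 0) xs) = replicate k 0 @ xs"
proof (induction xs arbitrary: k)
  case (Cons x xs)
  show ?case
  proof (cases "x = 0")
    case True
    with Cons.prems have "xs \<noteq> []" by auto
    with Cons.IH[of "Suc k"] Cons.prems True show ?thesis
      by (simp add: replicate_append_same replicate_app_Cons_same)
  next
    case False
    show ?thesis
    proof (cases "xs = []")
      case True
      with False show ?thesis by simp
    next
      case xs: False
      \<comment> \<open>The remaining image starts with a positive letter, so the run of zeros
        behind \<open>x\<close> has exactly the \<open>k\<close> zeros moved there.\<close>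
      with Cons.prems hd_swapz[of xs 0] obtain y ys where "swapz [] xs = y # ys" "y > 0"
        by (cases "swapz [] xs") auto
      with False xs Cons.IH[of 0] Cons.prems show ?thesis
        by (simp add: takeWhile_append dropWhile_append)
    qed
  qed
qed simp

lemma all_zero_iff_Pos: "(\<forall>y\<in>set u. y = 0) \<longleftrightarrow> Pos u = []"
  by (auto simp: Pos_def filter_empty_conv)

text \<open>The letter \<open>a\<close> of the recursion is the last letter of \<open>Pos u\<close>, and \<open>r \<ge> 1\<close> means that
  \<open>u\<close> ends in zero.\<close>
lemma bF3_snoc:
  "bF3 (u @ [b]) =
    (if Pos u = [] then u @ [b]
     else if last (Pos u) \<le> b then bF3 u @ [b]
     else if last u = 0 then 0 # butlast (bF3 u) @ [b]
     else swapz [] (bF3 u) @ [b])"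
proof -
  let ?r = "length (takeWhile (\<lambda>y. y = 0) (rev u))"
  have a: "u ! (length u - ?r - 1) = last (Pos u)" if "Pos u \<noteq> []"
    using that
  proof (induction u rule: rev_induct)
    case (snoc x u)
    then show ?case
      by (cases "u = []") (auto simp: nth_append split: if_splits)
  qed simp
  have r: "1 \<le> ?r \<longleftrightarrow> last u = 0" if "Pos u \<noteq> []"
    using that by (cases u rule: rev_cases) auto
  show ?thesis
    by (subst bF3.simps, cases "Pos u = []") (auto simp: all_zero_iff_Pos Let_def a[simplified] r[simplified] simp del: bF3.simps)
qed

declare bF3.simps [simp del]

lemma bF3_Nil [simp]: "bF3 [] = []"
  by (subst bF3.simps) simp

text \<open>The claim on the last letter supports the one on \<open>Pos\<close>: in case (2) the
  letter dropped from \<open>bF3 u\<close> is \<open>last u\<close>, a zero, and the new leading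
  zero replaces it.\<close>

lemma bF3_class: "length (bF3 w) = length w \<and> Pos (bF3 w) = Pos w \<and> (w \<noteq> [] \<longrightarrow> last (bF3 w) = last w)"
proof (induction w rule: rev_induct)
  case (snoc b u)
  show ?case
  proof (cases "Pos u = []")
    case False
    then have "u \<noteq> []" by auto
    with snoc have *: "bF3 u = butlast (bF3 u) @ [last u]"
      by (metis append_butlast_last_id length_0_conv)
    then have **: "Pos u = Pos (butlast (bF3 u)) @ Pos [last u]"
      by (metis snoc Pos_append)
    have "Pos (swapz [] (bF3 u)) = Pos u" "length (swapz [] (bF3 u)) = length u"
      using Pos_swapz[of 0 "bF3 u"] snoc by (auto simp: length_swapz)
    moreover have "Pos (butlast (bF3 u)) = Pos u" if "last u = 0"
      using ** that by simp
    ultimately show ?thesis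
      using snoc \<open>u \<noteq> []\<close> by (simp add: bF3_snoc)
  qed (simp add: bF3_snoc)
qed simp

text \<open>The last letter is kept, so \<open>Pos u\<close> is known, and with it whether case (1)
  applies. The first letter of the image separates cases (2) and (3), and each case can be
  undone.\<close>

lemma bF3_inj: "length w = length w' \<Longrightarrow> Pos w = Pos w' \<Longrightarrow> bF3 w = bF3 w' \<Longrightarrow> w = w'"
proof (induction w arbitrary: w' rule: rev_induct)
  case (snoc b u)
  then obtain u' b' where w': "w' = u' @ [b']" by (cases w' rule: rev_cases) auto
  have b: "b' = b" using snoc.prems w' bF3_class[of w'] bF3_class[of "u @ [b]"] by simp
  have len: "length u = length u'" using snoc.prems w' by simp
  have P: "Pos u = Pos u'" using snoc.prems w' b by (auto split: if_splits)
  have hd0: "swapz [] (bF3 y) \<noteq> [] \<and> hd (swapz [] (bF3 y)) \<noteq> 0" if "last y \<noteq> 0" "Pos y \<noteq> []" for y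
  proof -
    from that have "y \<noteq> []" by auto
    with that bF3_class[of y] have "bF3 y \<noteq> []" "last (bF3 y) > 0" by auto
    from hd_swapz[OF this, of 0] show ?thesis by simp
  qed
  consider "Pos u = []" | "Pos u \<noteq> []" "last (Pos u) \<le> b"
    | "Pos u \<noteq> []" "\<not> last (Pos u) \<le> b" "last u = 0" "last u' = 0"
    | "Pos u \<noteq> []" "\<not> last (Pos u) \<le> b" "last u \<noteq> 0" "last u' \<noteq> 0"
    | "Pos u \<noteq> []" "\<not> last (Pos u) \<le> b" "last u = 0 \<longleftrightarrow> last u' \<noteq> 0"
    by (cases "Pos u = []"; cases "last (Pos u) \<le> b"; cases "last u = 0"; cases "last u' = 0") simp_all
  then show ?case
  proof cases
    case 1
    with snoc.prems w' b P show ?thesis by (simp add: bF3_snoc)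
  next
    case 2
    with snoc.prems w' b P have "bF3 u = bF3 u'" by (simp add: bF3_snoc)
    with snoc.IH[OF len P] w' b show ?thesis by simp
  next
    case 3
    have "u \<noteq> []" "u' \<noteq> []" using 3 P by auto
    then have "bF3 u = butlast (bF3 u) @ [0]" "bF3 u' = butlast (bF3 u') @ [0]"
      using bF3_class[of u] bF3_class[of u'] 3 by (metis append_butlast_last_id length_0_conv)+
    moreover have "butlast (bF3 u) = butlast (bF3 u')"
      using 3 snoc.prems w' b P by (simp add: bF3_snoc)
    ultimately have "bF3 u = bF3 u'" by simp
    with snoc.IH[OF len P] w' b show ?thesis by simp
  next
    case 4
    have "u \<noteq> []" "u' \<noteq> []" using 4 P by auto
    then have "bF3 u \<noteq> []" "last (bF3 u) > 0" "bF3 u' \<noteq> []" "last (bF3 u') > 0"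
      using bF3_class[of u] bF3_class[of u'] 4 by auto
    moreover have "swapz [] (bF3 u) = swapz [] (bF3 u')"
      using 4 snoc.prems w' b P by (simp add: bF3_snoc)
    ultimately have "bF3 u = bF3 u'"
      using unswapz_swapz[of "bF3 u" 0] unswapz_swapz[of "bF3 u'" 0] by simp
    with snoc.IH[OF len P] w' b show ?thesis by simp
  next
    case 5
    have eq: "bF3 (u @ [b]) = bF3 (u' @ [b])" using snoc.prems w' b by simp
    \<comment> \<open>Exactly one of \<open>u\<close> and \<open>u'\<close> ends in zero here, so
      one image begins with zero and the other with a positive letter.\<close>
    have *: "hd (bF3 (y @ [b])) = 0 \<longleftrightarrow> last y = 0" if "y = u \<or> y = u'" for y
      using that 5 P hd0[of y] by (cases "last y = 0") (auto simp: bF3_snoc)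
    have "last u = 0 \<longleftrightarrow> last u' = 0" using *[of u] *[of u'] eq by simp
    with 5 show ?thesis by argo
  qed
qed simp

text \<open>Appending \<open>b\<close> changes nothing in case (1). In cases (2) and (3),
  \<open>b\<close> adds \<open>length (Pos u)\<close> on the right, as a descent of
  \<open>Pos\<close> if positive and through \<open>zinv\<close> if zero. In (2) moving a final zero
  to the front loses the same amount; in (3) the swap gains one per zero, for a total of
  \<open>length u\<close>, the new descent of the word.\<close>

lemma maj_bF3: "maj w = zinv 0 (bF3 w) + maj (Pos w)"
proof (induction w rule: rev_induct)
  case (snoc b u)
  show ?case
  proof (cases "Pos u = []")
    case True
    have "zinv 0 u = 0" using True by (induction u) (auto split: if_splits)
    moreover have "u = [] \<or> last u = 0" using True by (metis last_in_set all_zero_iff_Pos)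
    moreover have "DES u = {}"
      using True unfolding DES_def all_zero_iff_Pos[symmetric] by (auto simp: all_set_conv_all_nth)
    then have "maj u = 0" by (simp add: maj_def)
    ultimately show ?thesis using True maj_snoc[of "[]" b]
      by (auto simp: bF3_snoc zinv_append maj_snoc)
  next
    case P: False
    then have u: "u \<noteq> []" by auto
    let ?X = "butlast (bF3 u)"
    have X: "bF3 u = ?X @ [last u]"
      using bF3_class[of u] u by (metis append_butlast_last_id length_0_conv)
    have PX: "Pos (bF3 u) = Pos u" using bF3_class by blast
    have len: "length u = count_list (bF3 u) 0 + length (Pos u)"
      by (metis bF3_class length_eq_zeros_Pos)
    have lastp: "last (Pos u) = last u" if "last u \<noteq> 0"
      using u that by (cases u rule: rev_cases) auto
    have lp: "last (Pos u) > 0" using P unfolding Pos_def using last_in_set[of "filter ((<) 0) u"] by auto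
    \<comment> \<open>A final zero contributes all of \<open>length (Pos u)\<close>; placed in front
      it contributes nothing.\<close>
    have z: "zinv 0 (bF3 u) = zinv 0 ?X + (if last u = 0 then length (Pos u) else 0)"
      using X zinv_append[of 0 ?X "[last u]"] PX Pos_append[of ?X "[last u]"] by auto
    have PX0: "Pos ?X = Pos u" if "last u = 0"
      using X PX that Pos_append[of ?X "[last u]"] by auto
    consider "last (Pos u) \<le> b" | "\<not> last (Pos u) \<le> b" "last u = 0" | "\<not> last (Pos u) \<le> b" "last u \<noteq> 0"
      by blast
    then show ?thesis
    proof cases
      case 1
      then have "b > 0" "last u \<le> b" using lp lastp by (cases "last u = 0"; simp)+
      with 1 P u show ?thesis by (simp add: bF3_snoc zinv_append maj_snoc snoc)
    next
      case 2
      then show ?thesis using P u z PX0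
        by (auto simp: bF3_snoc zinv_append maj_snoc snoc)
    next
      case 3
      have "zinv 0 (swapz [] (bF3 u)) = zinv 0 (bF3 u) + count_list (bF3 u) 0"
        using zinv_swapz[of "bF3 u" 0 0] 3 bF3_class[of u] u by fastforce
      moreover have "Pos (swapz [] (bF3 u)) = Pos u" using Pos_swapz[of 0] PX by simp
      ultimately show ?thesis using 3 P u lastp len
        by (auto simp: bF3_snoc zinv_append maj_snoc snoc)
    qed
  qed
qed simp

lemma mafz_bF3: "mafz (bF3 w) = int (maj w)"
  using bF3_class[of w] maj_bF3[of w] by (simp add: mafz_eq_zinv)

subsection \<open>The map \<open>\<Phi>\<close>\<close>

lemma adj_eq_replicateI:
  assumes "length xs = Suc n" "\<And>i. i < n \<Longrightarrow> (xs ! i \<le> xs ! Suc i) = b"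
  shows "adj xs = replicate n b"
  using assms by (intro nth_equalityI) (auto simp: nth_adj)

section \<open>A single step \<open>phi l\<close> around the \<open>l\<close>-th zero\<close>

context
  fixes w A B :: "nat list" and l :: nat
  assumes w: "w = A @ 0 # B" and der: "derword (Pos w)" and l: "l = Suc (count_list A 0)"
begin

private abbreviation "pA \<equiv> length (Pos A)"

lemma zero_key: "key l 0 w = map ((*) 2) A @ 0 # key 0 pA B"
  by (simp add: w l key_append key_all)

lemma nth_left: "1 \<le> i \<Longrightarrow> i \<le> length A \<Longrightarrow> w ! (i - 1) = A ! (i - 1)"
  by (auto simp: w nth_append)

lemma nth_right: "w ! (length A + Suc t) = B ! t"
  by (simp add: w nth_append)

lemma redW_left: "i \<le> length A \<Longrightarrow> redW w i = length (Pos (take i A))"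
  by (simp add: redW_def w Pos_def)

lemma redW_right: "redW w (Suc (length A + t)) = pA + length (Pos (take t B))"
  by (simp add: redW_def w Pos_def)

lemma subexc_left: "subexc w (length A) \<longleftrightarrow> A \<noteq> [] \<and> 0 < last A \<and> last A < pA"
proof (cases "A = []")
  case False
  then have "w ! (length A - 1) = last A" using nth_left[of "length A"] by (simp add: last_conv_nth Suc_le_eq)
  with False show ?thesis
    using redW_left[of "length A"] by (simp add: subexc_def Suc_le_eq) (simp add: w)
qed (simp add: subexc_def)

lemma subexc_right: "subexc w (Suc (Suc (length A))) \<longleftrightarrow> B \<noteq> [] \<and> 0 < hd B \<and> hd B \<le> pA"
proof (cases "B = []")
  case False
  then have "w ! Suc (length A) = hd B" using nth_right[of 0] by (simp add: hd_conv_nth)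
  moreover have "redW w (Suc (Suc (length A))) = pA + (if hd B = 0 then 0 else 1)"
    using redW_right[of 1] False by (cases B) simp_all
  moreover have "Suc (Suc (length A)) \<le> length w" using False by (simp add: w Suc_le_eq)
  ultimately show ?thesis using False by (auto simp: subexc_def)
qed (simp add: subexc_def w)

lemma last_left:
  assumes "A \<noteq> []" "0 < last A"
  shows "last A \<noteq> pA" "B \<noteq> [] \<Longrightarrow> last A \<noteq> hd B"
proof -
  obtain A0 a where A: "A = A0 @ [a]" using assms(1) by (cases A rule: rev_cases) auto
  then have "derword (Pos (A0 @ a # 0 # B))" using der by (simp add: w)
  note d = derword_split[OF this]
  show "last A \<noteq> pA" using d(1) assms(2) by (simp add: A)
  show "last A \<noteq> hd B" if "B \<noteq> []" using d(3) assms(2) that by (auto simp: A)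
qed

text \<open>The unsimplified arithmetic here and in \<open>left_end\<close> matches the terms that
  \<open>phi_def\<close> yields for \<open>j = Suc (length A)\<close>, so that they can be
  folded.\<close>

private definition right_end :: nat where
  "right_end = (GREATEST k. Suc (length A) + 1 \<le> k \<and> k \<le> length w \<and>
     (\<forall>t. Suc (length A) + 1 \<le> t \<and> t < k \<longrightarrow> w ! (t - 1) < w ! (t + 1 - 1)) \<and> w ! (k - 1) < redW w k)"

private definition left_end :: nat where
  "left_end = (LEAST i. 1 \<le> i \<and> i \<le> Suc (length A) - 1 \<and> w ! (i - 1) < redW w i \<and>
     (\<forall>t. i \<le> t \<and> t < Suc (length A) - 1 \<longrightarrow> w ! (t + 1 - 1) < w ! (t - 1)))"

text \<open>Two subexcedent neighbours of the zero are distinct letters of \<open>Pos w\<close>, so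
  the final \<open>else\<close> of \<open>phi\<close> is never reached and three branches
  remain.\<close>

lemma phi_unfold:
  "phi l w =
    (if \<not> subexc w (length A) \<and> \<not> subexc w (Suc (Suc (length A))) then w
     else if subexc w (Suc (Suc (length A))) \<and> (\<not> subexc w (length A) \<or> hd B < last A) then
       A @ take (right_end - Suc (length A)) B @ 0 # drop right_end w
     else
       take (left_end - 1) w @ 0 # take (Suc (length A) - left_end) (drop (left_end - 1) w) @ B)"
proof -
  have le: "\<not> (l < 1 \<or> length w - length (Pos w) < l)"
    using length_eq_zeros_Pos[of w] l by (simp add: w)
  have j: "zeropos w l = Suc (length A)" using zeropos_split w l by blast
  have xl: "w ! (length A - 1) = last A" if "subexc w (length A)"
    using that nth_left[of "length A"] by (auto simp: subexc_left last_conv_nth Suc_le_eq)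
  have xr: "w ! Suc (length A) = hd B" if "subexc w (Suc (Suc (length A)))"
    using that nth_right[of 0] by (auto simp: subexc_right hd_conv_nth)
  have ne: "last A \<noteq> hd B" if "subexc w (length A)" "subexc w (Suc (Suc (length A)))"
    using that last_left by (auto simp: subexc_left subexc_right)
  have t: "take (length A) w = A" "drop (Suc (length A)) w = B" by (simp_all add: w)
  show ?thesis
    unfolding phi_def Let_def if_not_P[OF le] j right_end_def[symmetric] left_end_def[symmetric]
  proof (cases "subexc w (length A) \<and> subexc w (Suc (Suc (length A)))", goal_cases)
    case 1
    with xl xr have "w ! (length A - Suc 0) = last A" "w ! Suc (length A) = hd B" by auto
    moreover from 1 ne have "last A < hd B \<or> hd B < last A" by auto
    ultimately show ?case using 1 by (auto simp: t)
  next
    case 2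
    then show ?case by (auto simp: t)
  qed
qed

text \<open>Only the two comparisons with the zero can change. A neighbouring excedent letter
  exceeds both values of the zero; a zero on the left gives a rise for both values, and so does a
  zero on the right.\<close>

lemma phi_stay:
  assumes "\<not> subexc w (length A)" "\<not> subexc w (Suc (Suc (length A)))"
  shows "adj (key l 0 w) = adj (map ((*) 2) A @ (2 * pA + 1) # key 0 pA B)"
proof -
  have "adj (map ((*) 2) A @ [0] @ key 0 pA B) = adj (map ((*) 2) A @ [2 * pA + 1] @ key 0 pA B)"
  proof (rule adj_replace)
    assume "map ((*) 2) A \<noteq> []"
    then have "A \<noteq> []" by simp
    with assms(1) last_left show "(last (map ((*) 2) A) \<le> hd [0]) = (last (map ((*) 2) A) \<le> hd [2 * pA + 1])"
      by (cases "last A = 0") (auto simp: subexc_left last_map)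
  next
    assume "key 0 pA B \<noteq> []"
    with assms(2) show "(last [0] \<le> hd (key 0 pA B)) = (last [2 * pA + 1] \<le> hd (key 0 pA B))"
      by (auto simp: subexc_right hd_key)
  qed auto
  then show ?thesis by (simp add: zero_key)
qed

text \<open>The zero crosses an increasing run of subexcedent letters. As smallest letter in front
  of it and as in-between value behind it, it gives a block with rises only. The left joint is
  unchanged since \<open>last A\<close> is zero or exceeds \<open>hd B\<close>, the right joint by
  maximality of the run.\<close>

lemma phi_right:
  assumes R: "subexc w (Suc (Suc (length A)))" and L: "\<not> subexc w (length A) \<or> hd B < last A"
  obtains c where "phi l w = A @ take c B @ 0 # drop c B" "0 \<notin> set (take c B)"
    "adj (key l 0 w) = adj (key (l - 1) 0 (phi l w))"
proof -
  let ?P = "\<lambda>k. length A + 2 \<le> k \<and> k \<le> length w \<and>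
    (\<forall>t. length A + 2 \<le> t \<and> t < k \<longrightarrow> w ! (t - 1) < w ! t) \<and> w ! (k - 1) < redW w k"
  define k where "k = (GREATEST k. ?P k)"
  have k_end: "right_end = k" by (simp add: k_def right_end_def)
  from R have B: "B \<noteq> []" "0 < hd B" "hd B \<le> pA" by (auto simp: subexc_right)
  have hdB: "B ! 0 = hd B" using B by (simp add: hd_conv_nth)
  have "length (Pos (take 1 B)) = 1" using B by (cases B) auto
  then have P0: "?P (length A + 2)"
    using B nth_right[of 0] redW_right[of 1] hdB by (auto simp: w Suc_le_eq)
  have bound: "y \<le> length w" if "?P y" for y using that by blast
  have Pk: "?P k" unfolding k_def by (rule GreatestI_nat[of ?P, OF P0 bound])
  have Pmax: "\<not> ?P (Suc k)"
    using Greatest_le_nat[of ?P "Suc k" "length w"] bound unfolding k_def[symmetric] by fastforce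
  define c where "c = k - Suc (length A)"
  have k: "k = Suc (length A + c)" and c0: "c > 0" and cB: "c \<le> length B"
    using Pk by (auto simp: c_def w)
  have chain: "B ! t < B ! Suc t" if "Suc t < c" for t
    using Pk[THEN conjunct2, THEN conjunct2, THEN conjunct1, rule_format, of "length A + 2 + t"]
      that nth_right[of t] nth_right[of "Suc t"] k by simp
  have pos: "0 < B ! t" if "t < c" for t
    using that
  proof (induction t)
    case 0
    then show ?case using B hdB by simp
  next
    case (Suc t)
    then show ?case using chain[of t] by simp
  qed
  let ?C = "take c B" and ?Q = "drop c B"
  have nz: "0 \<notin> set ?C" using pos cB by (auto simp: in_set_conv_nth)
  have pC: "length (Pos ?C) = c" using Pos_id[OF nz] cB by simp
  have C: "?C \<noteq> []" using c0 B by simp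
  have lastC: "last ?C = B ! (c - 1)" using C cB by (simp add: last_conv_nth)
  have hdC: "hd ?C = hd B" using c0 by simp
  \<comment> \<open>The last crossed letter is subexcedent at place \<open>pA + c\<close>, hence
    below the new value \<open>2 * (pA + c) + 1\<close> of the zero behind it.\<close>
  have top: "B ! (c - 1) < pA + c"
    using Pk nth_right[of "c - 1"] redW_right[of c] pC c0 by (simp add: k)
  \<comment> \<open>A positive next letter that is larger and not excedent would extend the run,
    against the choice of \<open>k\<close>.\<close>
  have maxi: "hd ?Q \<le> B ! (c - 1) \<or> pA + c < hd ?Q" if "?Q \<noteq> []" "hd ?Q > 0"
  proof (rule ccontr)
    assume H: "\<not> ?thesis"
    have cB': "c < length B" using that by simp
    then have hdQ: "hd ?Q = B ! c" by (simp add: hd_drop_conv_nth)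
    have "length (Pos (take (Suc c) B)) = Suc c"
      using pC that hdQ cB' by (simp add: take_Suc_conv_app_nth)
    then have r: "w ! k < redW w (Suc k)"
      using H hdQ redW_right[of "Suc c"] nth_right[of c] by (simp add: k)
    have "w ! (k - 1) < w ! k"
      using H hdQ nth_right[of "c - 1"] nth_right[of c] c0 by (simp add: k)
    then have "w ! (t - 1) < w ! t" if "length A + 2 \<le> t" "t < Suc k" for t
      using Pk that by (cases "t = k") auto
    with r Pmax Pk cB' show False by (auto simp: k w)
  qed
  have neq: "hd ?Q \<noteq> B ! (c - 1)" if "?Q \<noteq> []" "hd ?Q > 0"
  proof -
    obtain q Q where q: "?Q = q # Q" using \<open>?Q \<noteq> []\<close> by (cases ?Q) auto
    have "w = (A @ 0 # ?C) @ q # Q" using w q by (metis append_take_drop_id append.assoc append_Cons)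
    with der derword_split[of "A @ 0 # ?C" q Q] that q have "q \<notin> set ?C" by auto
    moreover have "last ?C \<in> set ?C" using C by (rule last_in_set)
    ultimately show ?thesis using lastC q by auto
  qed
  have phi: "phi l w = A @ ?C @ 0 # ?Q"
  proof -
    have "drop k w = ?Q" "take (k - Suc (length A)) B = ?C" by (simp_all add: k w)
    with R L phi_unfold show ?thesis by (auto simp: k_end)
  qed
  let ?K = "key 0 (pA + c) ?Q" and ?A = "map ((*) 2) A" and ?C2 = "map ((*) 2) ?C"
  have "key 0 pA B = key 0 pA (?C @ ?Q)" by simp
  also have "\<dots> = ?C2 @ ?K" unfolding key_append using pC key_pos[OF nz] by simp
  finally have kB: "key l 0 w = ?A @ (0 # ?C2) @ ?K" by (simp add: zero_key)
  have cC: "count_list ?C 0 = 0" using nz by (simp add: count_list_0_iff)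
  have "key (l - 1) 0 (phi l w) = ?A @ (?C2 @ [2 * (pA + c) + 1]) @ ?K"
    unfolding phi by (simp add: l key_append key_all key_pos[OF nz] pC cC)
  moreover have "adj (?A @ (0 # ?C2) @ ?K) = adj (?A @ (?C2 @ [2 * (pA + c) + 1]) @ ?K)"
  proof (rule adj_replace)
    have "adj (0 # ?C2) = replicate c True"
      using cB chain by (intro adj_eq_replicateI) (auto simp: nth_Cons less_imp_le split: nat.splits)
    moreover have "adj (?C2 @ [2 * (pA + c) + 1]) = replicate c True"
    proof (intro adj_eq_replicateI)
      fix i assume i: "i < c"
      show "((?C2 @ [2 * (pA + c) + 1]) ! i \<le> (?C2 @ [2 * (pA + c) + 1]) ! Suc i) = True"
      proof (cases "Suc i = c")
        case True
        then have "B ! i < pA + c" using top by auto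
        then show ?thesis using True i cB by (simp add: nth_append)
      next
        case False
        then show ?thesis using i cB chain[of i] by (simp add: nth_append)
      qed
    qed (use cB in simp)
    ultimately show "adj (0 # ?C2) = adj (?C2 @ [2 * (pA + c) + 1])" by simp
  next
    assume "?A \<noteq> []"
    then have A: "A \<noteq> []" by simp
    have "last A = 0 \<or> hd B < last A"
      using L B last_left A by (cases "last A = 0") (auto simp: subexc_left)
    then show "(last ?A \<le> hd (0 # ?C2)) = (last ?A \<le> hd (?C2 @ [2 * (pA + c) + 1]))"
      using A C hdC by (auto simp: last_map hd_map)
  next
    assume "?K \<noteq> []"
    then have Q: "?Q \<noteq> []" by simp
    show "(last (0 # ?C2) \<le> hd ?K) = (last (?C2 @ [2 * (pA + c) + 1]) \<le> hd ?K)"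
    proof (cases "hd ?Q = 0")
      case True
      then show ?thesis using C top lastC hd_key[OF Q, of "pA + c"] by (simp add: last_map)
    next
      case False
      with maxi[OF Q] neq[OF Q] top show ?thesis
        using C lastC hd_key[OF Q, of "pA + c"] by (auto simp: last_map)
    qed
  qed (use C in auto)
  ultimately have "adj (key l 0 w) = adj (key (l - 1) 0 (phi l w))" by (simp only: kB)
  with phi nz that show thesis by blast
qed

text \<open>Mirror image of \<open>phi_right\<close>: the crossed run decreases, and it yields
  descents only, both with the smallest letter behind it and with the in-between value in
  front.\<close>

lemma phi_left:
  assumes L: "subexc w (length A)" and R: "\<not> subexc w (Suc (Suc (length A))) \<or> last A < hd B"
  obtains d where "phi l w = take d A @ 0 # drop d A @ B" "0 \<notin> set (drop d A)"
    "adj (key l 0 w) = adj (key (l - 1) 0 (phi l w))"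
proof -
  let ?P = "\<lambda>i. 1 \<le> i \<and> i \<le> length A \<and> w ! (i - 1) < redW w i \<and>
    (\<forall>t. i \<le> t \<and> t < length A \<longrightarrow> w ! (t - 1) > w ! t)"
  define i where "i = (LEAST i. ?P i)"
  have i_end: "left_end = i" by (simp add: i_def left_end_def)
  from L have A: "A \<noteq> []" "0 < last A" "last A < pA" by (auto simp: subexc_left)
  have P0: "?P (length A)"
    using A nth_left[of "length A"] redW_left[of "length A"] by (auto simp: last_conv_nth Suc_le_eq)
  have Pi: "?P i" unfolding i_def by (rule LeastI[of ?P, OF P0])
  have Pmin: "\<not> ?P j" if "j < i" for j
    using that not_less_Least[of j ?P] unfolding i_def by blast
  define d where "d = i - 1"
  have i: "i = Suc d" and dA: "d < length A" using Pi by (auto simp: d_def)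
  have chain: "A ! t > A ! Suc t" if "d \<le> t" "Suc t < length A" for t
    using Pi[THEN conjunct2, THEN conjunct2, THEN conjunct2, rule_format, of "Suc t"] that
      nth_left[of "Suc t"] nth_left[of "Suc (Suc t)"] i by simp
  \<comment> \<open>Induction from the right end of \<open>A\<close>: leftwards the letters grow
    from the positive \<open>last A\<close>.\<close>
  have pos: "0 < A ! (length A - Suc t)" if "t < length A - d" for t
    using that
  proof (induction t)
    case 0
    then show ?case using A by (simp add: last_conv_nth)
  next
    case (Suc t)
    then have "Suc (length A - Suc (Suc t)) = length A - Suc t" by simp
    moreover have "d \<le> length A - Suc (Suc t)" using Suc.prems by arith
    ultimately show ?case
      using Suc chain[of "length A - Suc (Suc t)"] by fastforce
  qed
  let ?D = "take d A" and ?C = "drop d A"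
  have nz: "0 \<notin> set ?C"
  proof
    assume "0 \<in> set ?C"
    then obtain t where "t < length A - d" "A ! (d + t) = 0" by (auto simp: in_set_conv_nth)
    moreover have "length A - Suc (d + t) < length A - d" using calculation by arith
    ultimately show False using pos[of "length A - Suc (d + t)"] by simp
  qed
  let ?p = "length (Pos ?D)"
  have AD: "A = ?D @ ?C" by simp
  have pA: "pA = ?p + length ?C"
    using arg_cong[OF AD, of Pos] Pos_id[OF nz] by (simp only: Pos_append length_append)
  have C: "?C \<noteq> []" using dA by simp
  have hdC: "hd ?C = A ! d" using dA by (simp add: hd_drop_conv_nth)
  have lastC: "last ?C = last A" using dA by simp
  have Ad: "0 < A ! d" using nz hdC C by (metis gr0I hd_in_set)
  have bot: "A ! d \<le> ?p"
    using Pi nth_left[of i] redW_left[of i] dA Ad by (simp add: i take_Suc_conv_app_nth)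
  \<comment> \<open>The letter before the run has place \<open>?p\<close> and differs from it. If
    not excedent it is subexcedent, so if also larger than \<open>A ! d\<close> it would extend the
    run.\<close>
  have mini: "last ?D \<le> A ! d \<or> ?p < last ?D" if D: "?D \<noteq> []" "last ?D > 0"
  proof (rule ccontr)
    assume H: "\<not> ?thesis"
    from D have d0: "d > 0" by auto
    then have lD: "last ?D = A ! (d - 1)" using D dA by (simp add: last_conv_nth)
    obtain D' where D': "?D = D' @ [last ?D]" using D by (metis append_butlast_last_id)
    then have "w = D' @ last ?D # ?C @ 0 # B"
      using w AD by (metis append.assoc append_Cons append_Nil)
    moreover have "?p = Suc (length (Pos D'))" using D' D(2) by (metis Pos_Cons Pos_Nil Pos_append length_append_singleton less_numeral_extra(3))
    ultimately have "last ?D \<noteq> ?p" using der derword_split(1)[of D' "last ?D" "?C @ 0 # B"] D(2) by auto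
    with H have 1: "A ! (d - 1) < ?p" "A ! d < A ! (d - 1)" using lD by auto
    have "?P d"
    proof (intro conjI allI impI)
      show "w ! (d - 1) < redW w d" using 1 d0 dA nth_left[of d] redW_left[of d] by simp
      fix t assume "d \<le> t \<and> t < length A"
      then show "w ! (t - 1) > w ! t"
        using Pi 1 d0 i nth_left[of d] nth_left[of "Suc d"] dA by (cases "t = d") auto
    qed (use d0 dA in auto)
    with Pmin[of d] i show False by blast
  qed
  have phi: "phi l w = ?D @ 0 # ?C @ B"
  proof -
    have "last A \<noteq> hd B \<or> B = []" using last_left A by auto
    then have "\<not> (subexc w (Suc (Suc (length A))) \<and> (\<not> subexc w (length A) \<or> hd B < last A))"
      using R L by auto
    moreover have "take (i - 1) w = ?D" "take (Suc (length A) - i) (drop (i - 1) w) = ?C"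
      using dA by (simp_all add: i w)
    ultimately show ?thesis
      using L phi_unfold by (auto simp: i_end)
  qed
  let ?K = "key 0 pA B" and ?D2 = "map ((*) 2) ?D" and ?C2 = "map ((*) 2) ?C"
  have "map ((*) 2) A = ?D2 @ ?C2" by (metis AD map_append)
  then have k1: "key l 0 w = ?D2 @ (?C2 @ [0]) @ ?K" by (simp add: zero_key)
  have "count_list A 0 = count_list ?D 0 + count_list ?C 0" by (metis AD count_list_append)
  then have cD: "count_list ?D 0 = l - 1" and cC: "count_list ?C 0 = 0"
    using nz l by (simp_all add: count_list_0_iff)
  have "key (l - 1) 0 (phi l w) = ?D2 @ ((2 * ?p + 1) # ?C2) @ ?K"
    by (simp add: phi key_append key_all key_pos[OF nz] cD cC Pos_id[OF nz] pA)
  moreover have "adj (?D2 @ (?C2 @ [0]) @ ?K) = adj (?D2 @ ((2 * ?p + 1) # ?C2) @ ?K)"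
  proof (rule adj_replace)
    have "adj ((2 * ?p + 1) # ?C2) = replicate (length ?C) False"
      using bot chain dA by (intro adj_eq_replicateI) (auto simp: nth_Cons not_le split: nat.splits)
    moreover have "adj (?C2 @ [0]) = replicate (length ?C) False"
    proof (intro adj_eq_replicateI)
      fix i assume i: "i < length ?C"
      show "((?C2 @ [0]) ! i \<le> (?C2 @ [0]) ! Suc i) = False"
      proof (cases "Suc i = length ?C")
        case True
        then have "d + i = length A - 1" by simp
        then have "A ! (d + i) > 0" using A by (simp add: last_conv_nth)
        then show ?thesis using True i by (simp add: nth_append)
      next
        case False
        then have "Suc (d + i) < length A" using i by simp
        then show ?thesis using False i chain[of "d + i"] by (simp add: nth_append)
      qed
    qed simp
    ultimately show "adj (?C2 @ [0]) = adj ((2 * ?p + 1) # ?C2)" by simp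
  next
    assume "?D2 \<noteq> []"
    then have D: "?D \<noteq> []" by simp
    show "(last ?D2 \<le> hd (?C2 @ [0])) = (last ?D2 \<le> hd ((2 * ?p + 1) # ?C2))"
      using mini[OF D] D C hdC bot by (cases "last ?D = 0") (auto simp: last_map hd_map)
  next
    assume "?K \<noteq> []"
    then have B: "B \<noteq> []" by simp
    have "last A \<le> hd B" if "hd B > 0"
      using R A B that by (auto simp: subexc_right)
    then have "2 * last A \<le> hd ?K"
      using A B by (auto simp: hd_key)
    then show "(last (?C2 @ [0]) \<le> hd ?K) = (last ((2 * ?p + 1) # ?C2) \<le> hd ?K)"
      using C lastC by (simp add: last_map)
  qed (use C in auto)
  ultimately have "adj (key l 0 w) = adj (key (l - 1) 0 (phi l w))" by (simp only: k1)
  with phi nz that show thesis by blast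
qed

text \<open>The crossed block contains no zero, so the moved zero is still the \<open>l\<close>-th
  one and the rest of the word is untouched.\<close>

lemma phi_moves_zero:
  "\<exists>A' B'. phi l w = A' @ 0 # B' \<and> A' @ B' = A @ B \<and> count_list A' 0 = count_list A 0 \<and>
     adj (key l 0 w) = adj (key (l - 1) 0 (phi l w))"
proof -
  have ne: "last A \<noteq> hd B" if "subexc w (length A)" "subexc w (Suc (Suc (length A)))"
    using that last_left by (auto simp: subexc_left subexc_right)
  consider (stay) "\<not> subexc w (length A)" "\<not> subexc w (Suc (Suc (length A)))"
    | (right) "subexc w (Suc (Suc (length A)))" "\<not> subexc w (length A) \<or> hd B < last A"
    | (left) "subexc w (length A)" "\<not> subexc w (Suc (Suc (length A))) \<or> last A < hd B"
    using ne by (meson linorder_neqE_nat)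
  then show ?thesis
  proof cases
    case stay
    then have "phi l w = w" using phi_unfold by simp
    moreover have "key (l - 1) 0 w = map ((*) 2) A @ (2 * pA + 1) # key 0 pA B"
      by (simp add: w l key_append key_all)
    ultimately show ?thesis using phi_stay[OF stay] w by auto
  next
    case right
    from phi_right[OF this] obtain c where c: "phi l w = A @ take c B @ 0 # drop c B"
      "0 \<notin> set (take c B)" "adj (key l 0 w) = adj (key (l - 1) 0 (phi l w))" .
    then show ?thesis
      by (intro exI[of _ "A @ take c B"] exI[of _ "drop c B"]) (simp add: count_list_0_iff)
  next
    case left
    from phi_left[OF this] obtain d where d: "phi l w = take d A @ 0 # drop d A @ B"
      "0 \<notin> set (drop d A)" "adj (key l 0 w) = adj (key (l - 1) 0 (phi l w))" .
    have "count_list A 0 = count_list (take d A) 0 + count_list (drop d A) 0"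
      by (metis append_take_drop_id count_list_append)
    with d show ?thesis
      by (intro exI[of _ "take d A"] exI[of _ "drop d A @ B"]) (simp add: count_list_0_iff)
  qed
qed

end

section \<open>Invariants and injectivity of the steps and their composition\<close>

lemma split_at_zero:
  assumes "0 < l" "l \<le> count_list w 0"
  obtains A B where "w = A @ 0 # B" "l = Suc (count_list A 0)"
proof -
  have "\<exists>A B. w = A @ 0 # B \<and> l = Suc (count_list A 0)"
    using assms
  proof (induction w rule: rev_induct)
    case (snoc x w)
    show ?case
    proof (cases "l \<le> count_list w 0")
      case True
      with snoc obtain A B where "w = A @ 0 # B" "l = Suc (count_list A 0)" by auto
      then show ?thesis by (intro exI[of _ A] exI[of _ "B @ [x]"]) simp
    next
      case False
      with snoc show ?thesis
        by (intro exI[of _ w] exI[of _ "[]"]) (auto split: if_splits)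
    qed
  qed simp
  then show thesis using that by blast
qed

lemma phi_trivial: "l = 0 \<or> count_list w 0 < l \<Longrightarrow> phi l w = w"
  using length_eq_zeros_Pos[of w] unfolding phi_def Let_def by (intro if_P) auto

lemma phi_class:
  assumes "derword (Pos w)"
  shows "length (phi l w) = length w" "Pos (phi l w) = Pos w"
    and "count_list (phi l w) 0 = count_list w 0"
    and "l > 0 \<Longrightarrow> adj (key l 0 w) = adj (key (l - 1) 0 (phi l w))"
proof -
  have "length (phi l w) = length w \<and> Pos (phi l w) = Pos w \<and> count_list (phi l w) 0 = count_list w 0 \<and>
    (l > 0 \<longrightarrow> adj (key l 0 w) = adj (key (l - 1) 0 (phi l w)))"
  proof (cases "0 < l \<and> l \<le> count_list w 0")
    case True
    then obtain A B where AB: "w = A @ 0 # B" "l = Suc (count_list A 0)" using split_at_zero by blast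
    from phi_moves_zero[OF AB(1) assms AB(2)] obtain A' B'
      where *: "phi l w = A' @ 0 # B'" "A' @ B' = A @ B" "count_list A' 0 = count_list A 0"
        "adj (key l 0 w) = adj (key (l - 1) 0 (phi l w))" by blast
    have "length A' + length B' = length A + length B" "Pos A' @ Pos B' = Pos A @ Pos B"
      "count_list A' 0 + count_list B' 0 = count_list A 0 + count_list B 0"
      using *(2) by (metis length_append, metis Pos_append, metis count_list_append)
    then have "length (phi l w) = length w" "Pos (phi l w) = Pos w" "count_list (phi l w) 0 = count_list w 0"
      unfolding *(1) by (simp_all add: AB(1))
    with *(4) show ?thesis by blast
  next
    case False
    then have "phi l w = w" by (intro phi_trivial) auto
    \<comment> \<open>Fewer than \<open>l\<close> zeros exist, so both levels make all of them
      smallest.\<close>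
    moreover have "key l 0 w = key (l - 1) 0 w" if "l > 0"
      using False that by (simp add: key_all)
    ultimately show ?thesis by simp
  qed
  then show "length (phi l w) = length w" "Pos (phi l w) = Pos w" "count_list (phi l w) 0 = count_list w 0"
    "l > 0 \<Longrightarrow> adj (key l 0 w) = adj (key (l - 1) 0 (phi l w))" by auto
qed

text \<open>Two candidate places of the \<open>l\<close>-th zero differ by a block \<open>T\<close>
  without zeros, and \<open>adj_insert_zero_neq\<close> applies because at level \<open>l\<close>
  this zero is smallest.\<close>

lemma key_zero_place_unique:
  assumes "A @ B = A' @ B'" "count_list A 0 = count_list A' 0" "l = Suc (count_list A 0)"
    and "adj (key l 0 (A @ 0 # B)) = adj (key l 0 (A' @ 0 # B'))"
  shows "A = A'"
proof -
  have *: False if T: "T \<noteq> []" "0 \<notin> set T" and c: "count_list S 0 = count_list A 0"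
    and eq: "adj (key l 0 (S @ 0 # T @ U)) = adj (key l 0 (S @ T @ 0 # U))" for S T U
  proof -
    have cT: "count_list T 0 = 0" using T by (simp add: count_list_0_iff)
    let ?T = "map ((*) 2) T"
    have "last T \<noteq> 0" using T last_in_set by metis
    then have "last ?T > 0" using T by (simp add: last_map)
    with adj_insert_zero_neq[of ?T "map ((*) 2) S" "key 0 (length (Pos S) + length T) U"] T eq c assms(3) cT
    show False by (simp add: key_append key_all key_pos Pos_id)
  qed
  from assms(1) obtain T where "A = A' @ T \<and> T @ B = B' \<or> A @ T = A' \<and> B = T @ B'"
    by (auto simp: append_eq_append_conv2)
  then show ?thesis
  proof
    assume T: "A = A' @ T \<and> T @ B = B'"
    then have "0 \<notin> set T" using assms(2) by (simp add: count_list_0_iff)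
    with *[of T A' B] T assms(2,4) show ?thesis by (cases "T = []") auto
  next
    assume T: "A @ T = A' \<and> B = T @ B'"
    then have "0 \<notin> set T" using assms(2) by (auto simp: count_list_0_iff)
    with *[of T A B'] T assms(4) show ?thesis by (cases "T = []") auto
  qed
qed

lemma zero_split_unique:
  "A @ 0 # B = A' @ 0 # B' \<Longrightarrow> count_list A 0 = count_list A' (0::nat) \<Longrightarrow> A = A' \<and> B = B'"
proof (induction A arbitrary: A')
  case Nil
  then show ?case by (cases A') auto
next
  case (Cons x A)
  then show ?case by (cases A') (auto split: if_splits)
qed

text \<open>Deleting the \<open>l\<close>-th zero of the image gives the word without its
  \<open>l\<close>-th zero, and the pattern of the image at level \<open>l - 1\<close> tells where
  to put it back.\<close>

lemma phi_inj:
  assumes "derword (Pos w)" "Pos w' = Pos w" "phi l w = phi l w'"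
  shows "w = w'"
proof -
  have der': "derword (Pos w')" using assms by simp
  have cw: "count_list w 0 = count_list w' 0"
    using phi_class(3)[OF assms(1), of l] phi_class(3)[OF der', of l] assms(3) by simp
  show ?thesis
  proof (cases "0 < l \<and> l \<le> count_list w 0")
    case True
    then obtain A B where AB: "w = A @ 0 # B" "l = Suc (count_list A 0)" using split_at_zero by blast
    from True cw have "0 < l" "l \<le> count_list w' 0" by auto
    then obtain C D where CD: "w' = C @ 0 # D" "l = Suc (count_list C 0)"
      using split_at_zero by blast
    from phi_moves_zero[OF AB(1) assms(1) AB(2)] obtain A' B'
      where 1: "phi l w = A' @ 0 # B'" "A' @ B' = A @ B" "count_list A' 0 = count_list A 0" by blast
    from phi_moves_zero[OF CD(1) der' CD(2)] obtain C' D'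
      where 2: "phi l w' = C' @ 0 # D'" "C' @ D' = C @ D" "count_list C' 0 = count_list C 0" by blast
    have cnt: "count_list A 0 = count_list C 0" using AB(2) CD(2) by simp
    then have "A' = C' \<and> B' = D'"
      using 1(1,3) 2(1,3) assms(3) by (intro zero_split_unique) simp_all
    then have eq: "A @ B = C @ D" using 1(2) 2(2) by simp
    have "adj (key l 0 w) = adj (key l 0 w')"
      using phi_class(4)[OF assms(1)] phi_class(4)[OF der'] assms(3) True by metis
    then have "A = C"
      using key_zero_place_unique[OF eq cnt AB(2)] unfolding AB(1) CD(1) by blast
    with eq AB(1) CD(1) show ?thesis by simp
  next
    case False
    then have "l = 0 \<or> count_list w 0 < l" by auto
    with cw have "phi l w = w" "phi l w' = w'" by (simp_all add: phi_trivial)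
    with assms(3) show ?thesis by metis
  qed
qed

lemma foldr_phi_class:
  assumes "derword (Pos w)"
  shows "length (foldr phi ls w) = length w" "Pos (foldr phi ls w) = Pos w"
proof (induction ls)
  case (Cons l ls)
  have "derword (Pos (foldr phi ls w))" using Cons assms by simp
  from phi_class(1,2)[OF this, of l] Cons
  show "length (foldr phi (l # ls) w) = length w" "Pos (foldr phi (l # ls) w) = Pos w" by simp_all
qed simp_all

lemma foldr_phi_inj:
  assumes "derword (Pos w)" "Pos w' = Pos w" "foldr phi ls w = foldr phi ls w'"
  shows "w = w'"
  using assms(3)
proof (induction ls)
  case (Cons l ls)
  have "Pos (foldr phi ls w) = Pos w" "Pos (foldr phi ls w') = Pos w"
    using assms(1,2) foldr_phi_class(2)[of w ls] foldr_phi_class(2)[of w' ls] by simp_all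
  then have "foldr phi ls w = foldr phi ls w'"
    using assms(1) Cons.prems phi_inj[of "foldr phi ls w" "foldr phi ls w'" l] by simp
  then show ?case by (rule Cons.IH)
qed simp

text \<open>\<open>foldr\<close> applies \<open>phi n\<close> first, so the induction descends from
  \<open>k = Suc n\<close>, where nothing is applied yet; each step lowers the level by one.\<close>

lemma adj_foldr_phi:
  assumes "derword (Pos w)" "1 \<le> k" "k \<le> Suc n"
  shows "adj (key (k - 1) 0 (foldr phi [k..<Suc n] w)) = adj (key n 0 w)"
  using assms(3,2)
proof (induction rule: inc_induct)
  case base
  then show ?case by simp
next
  case (step k)
  let ?u = "foldr phi [Suc k..<Suc n] w"
  have "[k..<Suc n] = k # [Suc k..<Suc n]" using step by (intro upt_conv_Cons) simp
  then have "foldr phi [k..<Suc n] w = phi k ?u" by (simp del: upt_Suc)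
  moreover have "derword (Pos ?u)"
    unfolding foldr_phi_class(2)[OF assms(1)] by (rule assms(1))
  then have "adj (key k 0 ?u) = adj (key (k - 1) 0 (phi k ?u))"
    using step.prems by (intro phi_class(4)) simp_all
  ultimately show ?case using step.IH by (simp del: upt_Suc)
qed

lemma bPhi_class:
  assumes "derword (Pos w)"
  shows "length (bPhi w) = length w" "Pos (bPhi w) = Pos w"
  unfolding bPhi_def by (rule foldr_phi_class[OF assms])+

lemma bPhi_inj:
  assumes "derword (Pos w)" "length w' = length w" "Pos w' = Pos w" "bPhi w = bPhi w'"
  shows "w = w'"
  using assms(4) unfolding bPhi_def assms(2) by (rule foldr_phi_inj[OF assms(1,3)])

lemma adj_double: "adj (map ((*) 2) xs) = adj xs"
  by (induction xs rule: adj.induct) auto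

lemma RISE_bPhi:
  assumes "derword (Pos w)"
  shows "RISE (key 0 0 (bPhi w)) = RISE w"
proof (rule RISE_eq)
  have "key (length w) 0 w = map ((*) 2) w"
    using length_eq_zeros_Pos[of w] by (intro key_all) simp
  then show "adj (key 0 0 (bPhi w)) = adj w"
    using adj_foldr_phi[OF assms, of 1 "length w"] by (simp add: bPhi_def adj_double del: upt_Suc)
qed (simp add: bPhi_class[OF assms])

subsection \<open>The encoding \<open>ZDer\<close>\<close>

text \<open>On \<open>S\<close> this is the increasing bijection onto \<open>{1..card S}\<close>;
  values outside \<open>S\<close> serve for counting positive letters in prefixes and for fixed
  points.\<close>

definition rank :: "nat set \<Rightarrow> nat \<Rightarrow> nat" where
  "rank S j = card {k \<in> S. k \<le> j}"

lemma rank_mono: "finite S \<Longrightarrow> i \<le> j \<Longrightarrow> rank S i \<le> rank S j"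
  unfolding rank_def by (rule card_mono) auto

lemma rank_less: "finite S \<Longrightarrow> i < j \<Longrightarrow> j \<in> S \<Longrightarrow> rank S i < rank S j"
proof -
  assume "finite S" "i < j" "j \<in> S"
  then have "{k \<in> S. k \<le> i} \<subseteq> {k \<in> S. k \<le> j}" "j \<in> {k \<in> S. k \<le> j}" "j \<notin> {k \<in> S. k \<le> i}"
    by auto
  then have "{k \<in> S. k \<le> i} \<subset> {k \<in> S. k \<le> j}" by blast
  with \<open>finite S\<close> show ?thesis unfolding rank_def by (intro psubset_card_mono) auto
qed

lemma rank_inj_on: "finite S \<Longrightarrow> inj_on (rank S) S"
  by (rule inj_onI) (metis linorder_neqE_nat rank_less nat_neq_iff)

lemma rank_bij:
  assumes "finite S"
  shows "bij_betw (rank S) S {1..card S}"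
proof -
  have "rank S k \<in> {1..card S}" if "k \<in> S" for k
  proof -
    have "rank S k \<noteq> 0" using that assms by (auto simp: rank_def)
    moreover have "rank S k \<le> card S" unfolding rank_def using assms by (intro card_mono) auto
    ultimately show ?thesis by simp
  qed
  then have "rank S ` S \<subseteq> {1..card S}" by blast
  moreover have "card (rank S ` S) = card {1..card S}"
    using rank_inj_on[OF assms] by (simp add: card_image)
  ultimately have "rank S ` S = {1..card S}" by (intro card_subset_eq) auto
  with rank_inj_on[OF assms] show ?thesis by (simp add: bij_betw_def)
qed

lemma rank_Suc: "finite S \<Longrightarrow> rank S (Suc j) = rank S j + (if Suc j \<in> S then 1 else 0)"
proof -
  assume S: "finite S"
  have "{k \<in> S. k \<le> Suc j} = {k \<in> S. k \<le> j} \<union> (if Suc j \<in> S then {Suc j} else {})"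
    by (auto simp: le_Suc_eq)
  then show ?thesis using S by (auto simp: rank_def)
qed

definition NZ :: "nat list \<Rightarrow> nat set" where
  "NZ w = {k. 1 \<le> k \<and> k \<le> length w \<and> w ! (k - 1) \<noteq> 0}"

lemma finite_NZ [simp]: "finite (NZ w)"
  by (rule finite_subset[of _ "{..length w}"]) (auto simp: NZ_def)

lemma Suc_in_NZ: "Suc i \<in> NZ w \<longleftrightarrow> i < length w \<and> w ! i \<noteq> 0"
  by (auto simp: NZ_def)

lemma NZ_E:
  assumes "k \<in> NZ w"
  obtains i where "k = Suc i" "i < length w" "w ! i \<noteq> 0"
  using assms by (cases k) (auto simp: NZ_def)

lemma length_Pos_take: "k \<le> length w \<Longrightarrow> length (Pos (take k w)) = rank (NZ w) k"
proof (induction k)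
  case 0
  have "{k \<in> NZ w. k \<le> 0} = {}" by (auto simp: NZ_def)
  then show ?case by (simp add: rank_def)
next
  case (Suc k)
  then show ?case by (simp add: take_Suc_conv_app_nth rank_Suc Suc_in_NZ)
qed

lemma length_Pos: "length (Pos w) = card (NZ w)"
proof -
  have "{k \<in> NZ w. k \<le> length w} = NZ w" by (auto simp: NZ_def)
  with length_Pos_take[of "length w" w] show ?thesis by (simp add: rank_def)
qed

lemma Pos_nth_rank:
  assumes "i < length w" "w ! i \<noteq> 0"
  shows "rank (NZ w) (Suc i) > 0" "rank (NZ w) (Suc i) \<le> length (Pos w)"
    and "Pos w ! (rank (NZ w) (Suc i) - 1) = w ! i"
proof -
  have r: "rank (NZ w) (Suc i) = Suc (length (Pos (take i w)))"
    using assms length_Pos_take[of i w] by (simp add: rank_Suc Suc_in_NZ)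
  have "w = take i w @ w ! i # drop (Suc i) w" using assms by (simp add: id_take_nth_drop)
  then have "Pos w = Pos (take i w) @ w ! i # Pos (drop (Suc i) w)"
    using assms(2) by (metis Pos_append Pos_Cons)
  then show "rank (NZ w) (Suc i) > 0" "rank (NZ w) (Suc i) \<le> length (Pos w)"
    "Pos w ! (rank (NZ w) (Suc i) - 1) = w ! i" unfolding r by simp_all
qed

lemma set_Pos: "set (Pos w) = {x \<in> set w. x \<noteq> 0}"
  by (auto simp: Pos_def)

text \<open>The union of the classes of shuffles of \<open>n - m\<close> zeros with a derangement of
  order \<open>m\<close>, over all \<open>m\<close>.\<close>

definition derclass :: "nat \<Rightarrow> nat list set" where
  "derclass n = {w. length w = n \<and> derword (Pos w) \<and> set (Pos w) = {1..length (Pos w)}}"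

lemma SnD:
  assumes "s \<in> Sn n"
  shows "length s = n" "distinct s" "set s = {1..n}"
  using assms by (auto simp: permutations_of_set_def dest: distinct_card)

lemma length_ZDer [simp]: "length (ZDer s) = length s"
  by (simp add: ZDer_def del: upt_Suc)

section \<open>From permutations to words\<close>

context
  fixes s :: "nat list" and n :: nat
  assumes s: "s \<in> Sn n"
begin

lemma ZDer_nth_raw: "i < n \<Longrightarrow> ZDer s ! i = (if s ! i = Suc i then 0 else redP s (s ! i))"
  using SnD(1)[OF s] by (simp add: ZDer_def del: upt_Suc)

lemma value_range: "i < n \<Longrightarrow> s ! i \<in> {1..n}"
  using SnD[OF s] nth_mem[of i s] by simp

text \<open>Otherwise the value would be taken at two positions. Hence \<open>redP\<close> is
  positive at values of nonfixed points, and zeros of \<open>ZDer s\<close> mark fixed points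
  only.\<close>

lemma nonfixed_value:
  assumes "i < n" "s ! i \<noteq> Suc i"
  shows "s ! (s ! i - 1) \<noteq> s ! i"
proof
  assume eq: "s ! (s ! i - 1) = s ! i"
  have "s ! i - 1 < n" "s ! i \<ge> 1" using value_range[OF assms(1)] by auto
  with eq SnD[OF s] assms(1) have "s ! i - 1 = i" by (simp add: nth_eq_iff_index_eq)
  with assms(2) \<open>s ! i \<ge> 1\<close> show False by simp
qed

lemma ZDer_eq_0: "i < n \<Longrightarrow> ZDer s ! i = 0 \<longleftrightarrow> s ! i = Suc i"
proof -
  assume i: "i < n"
  have "redP s (s ! i) \<noteq> 0" if "s ! i \<noteq> Suc i"
  proof -
    let ?S = "{k. 1 \<le> k \<and> k \<le> length s \<and> s ! (k - 1) \<noteq> k \<and> k \<le> s ! i}"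
    have "s ! i \<in> ?S" using nonfixed_value[OF i that] value_range[OF i] SnD(1)[OF s] by auto
    moreover have "finite ?S" by (rule finite_subset[of _ "{..length s}"]) auto
    ultimately have "card ?S > 0" unfolding card_gt_0_iff by blast
    then show ?thesis unfolding redP_def by (rule gr_implies_not0)
  qed
  then show ?thesis using ZDer_nth_raw[OF i] by simp
qed

lemma NZ_ZDer: "NZ (ZDer s) = {k. 1 \<le> k \<and> k \<le> length s \<and> s ! (k - 1) \<noteq> k}"
proof -
  have "ZDer s ! (k - 1) \<noteq> 0 \<longleftrightarrow> s ! (k - 1) \<noteq> k" if "1 \<le> k" "k \<le> n" for k
    using ZDer_eq_0[of "k - 1"] that by simp
  then show ?thesis unfolding NZ_def using SnD(1)[OF s] by auto
qed

lemma redP_eq_rank: "redP s = rank (NZ (ZDer s))"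
  unfolding NZ_ZDer by (rule ext) (simp add: redP_def rank_def conj_ac)

lemma ZDer_nth: "i < n \<Longrightarrow> ZDer s ! i = (if s ! i = Suc i then 0 else rank (NZ (ZDer s)) (s ! i))"
  using ZDer_nth_raw redP_eq_rank by simp

lemma value_in_NZ: "i < n \<Longrightarrow> s ! i \<in> NZ (ZDer s) \<longleftrightarrow> s ! i \<noteq> Suc i"
  using nonfixed_value[of i] value_range[of i] SnD(1)[OF s] unfolding NZ_ZDer by auto

lemma NZ_ZDer_values: "NZ (ZDer s) = {s ! i | i. i < n \<and> s ! i \<noteq> Suc i}"
proof -
  have "\<exists>i. k = s ! i \<and> i < n \<and> s ! i \<noteq> Suc i" if "k \<in> NZ (ZDer s)" for k
  proof -
    from that have "k \<in> set s" using SnD[OF s] unfolding NZ_ZDer by auto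
    then obtain i where "i < n" "s ! i = k" using SnD(1)[OF s] by (auto simp: in_set_conv_nth)
    with that value_in_NZ[of i] show ?thesis by auto
  qed
  then show ?thesis using value_in_NZ by blast
qed

lemma ZDer_in_derclass: "ZDer s \<in> derclass n"
proof -
  let ?w = "ZDer s" let ?r = "rank (NZ ?w)" let ?m = "length (Pos ?w)"
  have len: "length ?w = n" using SnD(1)[OF s] by simp
  have bij: "?r ` NZ ?w = {1..?m}" "inj_on ?r (NZ ?w)"
    using rank_bij[OF finite_NZ[of ?w]] by (auto simp: bij_betw_def length_Pos)
  have "set (Pos ?w) = ?r ` NZ ?w"
  proof -
    let ?I = "{i. i < n \<and> s ! i \<noteq> Suc i}"
    have "set (Pos ?w) = (!) ?w ` {i. i < n \<and> ?w ! i \<noteq> 0}"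
      unfolding set_Pos by (auto simp: in_set_conv_nth len[simplified])
    also have "{i. i < n \<and> ?w ! i \<noteq> 0} = ?I" by (intro Collect_cong conj_cong) (simp_all add: ZDer_eq_0)
    also have "(!) ?w ` ?I = (\<lambda>i. ?r (s ! i)) ` ?I" by (rule image_cong) (auto simp: ZDer_nth)
    also have "\<dots> = ?r ` {s ! i | i. i < n \<and> s ! i \<noteq> Suc i}" by blast
    finally show ?thesis using NZ_ZDer_values by simp
  qed
  with bij have set: "set (Pos ?w) = {1..?m}" by simp
  then have dist: "distinct (Pos ?w)" by (simp add: card_distinct)
  have "Pos ?w ! p \<noteq> Suc p" if "p < ?m" for p
  proof -
    have "Suc p \<in> ?r ` NZ ?w" using that bij by simp
    then obtain k where k: "k \<in> NZ ?w" "Suc p = ?r k" by blast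
    from k(1) obtain i where i: "k = Suc i" "i < n" "?w ! i \<noteq> 0" using len by (auto elim: NZ_E)
    have "?r (Suc i) - 1 = p" using k(2) i(1) by (metis diff_Suc_1)
    then have "Pos ?w ! p = ?w ! i" using Pos_nth_rank(3)[of i ?w] i len by simp
    \<comment> \<open>\<open>Suc i\<close> and \<open>s ! i\<close> are distinct nonfixed points, so
      their ranks, the place and the letter, differ.\<close>
    moreover have "s ! i \<noteq> Suc i" "s ! i \<in> NZ ?w" using i ZDer_eq_0 value_in_NZ by auto
    then have "?w ! i \<noteq> ?r k"
      using ZDer_nth[OF i(2)] bij(2) k(1) i(1) by (auto dest: inj_onD)
    ultimately show ?thesis using k by simp
  qed
  with set dist len show ?thesis by (simp add: derclass_def derword_def)
qed

text \<open>Reduces the claims on \<open>fix\<close> to those on \<open>Der\<close>.\<close>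

lemma fixpts_eq: "fixpts s = n - length (Der s)"
proof -
  have "{i. 1 \<le> i \<and> i \<le> length s \<and> s ! (i - 1) = i} = {1..n} - NZ (ZDer s)"
    unfolding NZ_ZDer using SnD(1)[OF s] by auto
  moreover have "NZ (ZDer s) \<subseteq> {1..n}" unfolding NZ_ZDer using SnD(1)[OF s] by auto
  ultimately show ?thesis
    by (simp add: fixpts_def Der_def length_Pos card_Diff_subset)
qed

text \<open>The key of \<open>ZDer s\<close> is the image of \<open>s\<close> under
  \<open>g\<close>: a fixed value gets an odd number just above all smaller nonfixed values. Only
  strict comparisons between two fixed values can be lost.\<close>

lemma RISE_key_ZDer: "RISE (key 0 0 (ZDer s)) = RISE s"
proof (rule RISE_eq)
  let ?w = "ZDer s" let ?r = "rank (NZ ?w)"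
  \<comment> \<open>Monotone, and constant only on runs of consecutive fixed points.\<close>
  define g where "g v = 2 * ?r v + (if v \<in> NZ ?w then 0 else 1)" for v
  have len: "length s = n" using SnD(1)[OF s] .
  have nth: "key 0 0 ?w ! i = g (s ! i)" if i: "i < n" for i
  proof (cases "s ! i = Suc i")
    case True
    then have "Suc i \<notin> NZ ?w" using value_in_NZ[OF i] by simp
    then have "?r (Suc i) = ?r i" by (simp add: rank_Suc)
    with True i len \<open>Suc i \<notin> NZ ?w\<close> show ?thesis
      using ZDer_eq_0[OF i] by (simp add: key_nth length_Pos_take g_def)
  next
    case False
    then show ?thesis
      using i len ZDer_eq_0[OF i] ZDer_nth[OF i] value_in_NZ[OF i] by (simp add: key_nth g_def)
  qed
  have gle: "g v \<le> g v'" if "v \<le> v'" for v v'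
    using that rank_less[of "NZ ?w" v v'] rank_mono[of "NZ ?w" v v']
    by (cases "v = v'") (auto simp: g_def)
  have gless: "g v < g v'" if "v < v'" "v \<in> NZ ?w \<or> v' \<in> NZ ?w" for v v'
    using that rank_less[of "NZ ?w" v v'] rank_mono[of "NZ ?w" v v']
    by (auto simp: g_def)
  have "(g (s ! i) \<le> g (s ! Suc i)) = (s ! i \<le> s ! Suc i)" if i: "Suc i < n" for i
  proof (cases "s ! i \<le> s ! Suc i")
    case False
    \<comment> \<open>Two adjacent fixed points form a rise, so a descent involves a nonfixed value,
      where \<open>g\<close> is strict.\<close>
    then have "s ! i \<in> NZ ?w \<or> s ! Suc i \<in> NZ ?w"
      using value_in_NZ[of i] value_in_NZ[of "Suc i"] i by auto
    with gless[of "s ! Suc i" "s ! i"] False show ?thesis by auto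
  qed (use gle in auto)
  then show "adj (key 0 0 ?w) = adj s"
    using len nth by (intro nth_equalityI) (auto simp: nth_adj)
qed simp

end

section \<open>Bijectivity of the encoding\<close>

text \<open>The zeros give the fixed points, hence the rank function, which is injective on the
  nonfixed values.\<close>

lemma ZDer_inj: "inj_on ZDer (Sn n)"
proof (rule inj_onI)
  fix s t assume s: "s \<in> Sn n" and t: "t \<in> Sn n" and eq: "ZDer s = ZDer t"
  have len: "length s = n" "length t = n" using SnD s t by blast+
  have "s ! i = t ! i" if i: "i < n" for i
  proof (cases "ZDer s ! i = 0")
    case True
    then show ?thesis using ZDer_eq_0[OF s i] ZDer_eq_0[OF t i] eq by simp
  next
    case False
    then have ne: "s ! i \<noteq> Suc i" "t ! i \<noteq> Suc i"
      using ZDer_eq_0[OF s i] ZDer_eq_0[OF t i] eq by auto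
    then have "rank (NZ (ZDer s)) (s ! i) = rank (NZ (ZDer s)) (t ! i)"
      using ZDer_nth[OF s i] ZDer_nth[OF t i] eq by simp
    moreover have "s ! i \<in> NZ (ZDer s)" "t ! i \<in> NZ (ZDer s)"
      using value_in_NZ[OF s i] value_in_NZ[OF t i] ne eq by auto
    ultimately show ?thesis using rank_inj_on[OF finite_NZ] by (auto dest: inj_onD)
  qed
  with len show "s = t" by (simp add: nth_equalityI)
qed

lemma ZDer_surj:
  assumes w: "w \<in> derclass n"
  shows "w \<in> ZDer ` Sn n"
proof -
  let ?Q = "NZ w" let ?r = "rank ?Q" let ?m = "length (Pos w)"
  have len: "length w = n" and dist: "distinct (Pos w)" and der: "\<And>p. p < ?m \<Longrightarrow> Pos w ! p \<noteq> Suc p"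
    and set: "set (Pos w) = {1..?m}"
    using w by (auto simp: derclass_def derword_def)
  have bij: "?r ` ?Q = {1..?m}" "inj_on ?r ?Q"
    using rank_bij[OF finite_NZ[of w]] by (auto simp: bij_betw_def length_Pos)
  \<comment> \<open>The inverse of red, from letters to nonzero positions.\<close>
  define J where "J = inv_into ?Q ?r"
  define s where "s = map (\<lambda>i. if w ! i = 0 then Suc i else J (w ! i)) [0..<n]"
  have range: "w ! i \<in> ?r ` ?Q" if "i < n" "w ! i \<noteq> 0" for i
    using that len set bij by (metis (mono_tags, lifting) mem_Collect_eq nth_mem set_Pos)
  have J: "J (w ! i) \<in> ?Q" "?r (J (w ! i)) = w ! i" if "i < n" "w ! i \<noteq> 0" for i
    unfolding J_def using range[OF that] by (rule inv_into_into, rule f_inv_into_f)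
  have nth: "s ! i = (if w ! i = 0 then Suc i else J (w ! i))" if "i < n" for i
    using that by (simp add: s_def)
  have ls: "length s = n" by (simp add: s_def)
  \<comment> \<open>The derangement condition enters here: a fixed point at a nonzero position would
    put a letter of \<open>Pos w\<close> in its own place.\<close>
  have nofix: "J (w ! i) \<noteq> Suc i" if "i < n" "w ! i \<noteq> 0" for i
  proof
    assume "J (w ! i) = Suc i"
    then have "?r (Suc i) = w ! i" using J(2)[OF that] by simp
    then have "?r (Suc i) > 0" "?r (Suc i) \<le> ?m" "Pos w ! (?r (Suc i) - 1) = ?r (Suc i)"
      using Pos_nth_rank[of i w] that len by simp_all
    then show False using der[of "?r (Suc i) - 1"] by (cases "?r (Suc i)") auto
  qed
  have inj: "i = j" if ij: "i < n" "j < n" "s ! i = s ! j" for i j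
  proof -
    have mixed: "J (w ! b) \<noteq> Suc a" if "a < n" "b < n" "w ! a = 0" "w ! b \<noteq> 0" for a b
      using J(1)[of b] that Suc_in_NZ[of a w] by auto
    show ?thesis
    proof (cases "w ! i = 0 \<or> w ! j = 0")
      case True
      then show ?thesis using mixed[of i j] mixed[of j i] ij nth[of i] nth[of j] by (auto split: if_splits)
    next
      case False
      then have "w ! i = w ! j" using J(2)[of i] J(2)[of j] ij nth by metis
      moreover have "Suc i \<in> ?Q" "Suc j \<in> ?Q" using False ij len by (auto simp: Suc_in_NZ)
      moreover have "?r (Suc i) - 1 < ?m" "?r (Suc j) - 1 < ?m" "?r (Suc i) > 0" "?r (Suc j) > 0"
        using Pos_nth_rank(1,2)[of i w] Pos_nth_rank(1,2)[of j w] False ij len by auto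
      ultimately have "?r (Suc i) = ?r (Suc j)"
        using Pos_nth_rank(3)[of i w] Pos_nth_rank(3)[of j w] False ij len dist
        by (metis Suc_diff_1 nth_eq_iff_index_eq)
      with bij(2) \<open>Suc i \<in> ?Q\<close> \<open>Suc j \<in> ?Q\<close> show ?thesis by (auto dest: inj_onD)
    qed
  qed
  have ds: "distinct s" using inj ls by (auto simp: distinct_conv_nth)
  have "set s \<subseteq> {1..n}"
  proof
    fix x assume "x \<in> set s"
    then obtain i where i: "i < n" "x = s ! i" using ls by (auto simp: in_set_conv_nth)
    show "x \<in> {1..n}"
    proof (cases "w ! i = 0")
      case False
      then have "x \<in> ?Q" using J(1)[of i] i nth by simp
      then show ?thesis using len by (auto simp: NZ_def)
    qed (use i nth in auto)
  qed
  moreover have "card (set s) = n" using ds ls by (simp add: distinct_card)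
  ultimately have "set s = {1..n}" by (intro card_subset_eq) auto
  with ds have sS: "s \<in> Sn n" by (simp add: permutations_of_set_def)
  have fix0: "s ! i = Suc i \<longleftrightarrow> w ! i = 0" if "i < n" for i
    using that nth nofix by auto
  have "NZ (ZDer s) = ?Q"
    unfolding NZ_def using fix0 ZDer_eq_0[OF sS] ls len
    by (intro Collect_cong conj_cong refl) auto
  then have "ZDer s ! i = w ! i" if "i < n" for i
    using ZDer_nth[OF sS that] fix0[OF that] J(2)[OF that] nth[OF that] by auto
  then have "ZDer s = w" using ls len by (intro nth_equalityI) auto
  with sS show ?thesis by blast
qed

lemma ZDer_bij: "bij_betw ZDer (Sn n) (derclass n)"
  unfolding bij_betw_def using ZDer_inj ZDer_in_derclass ZDer_surj by blast

subsection \<open>Transport to permutations\<close>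

lemma finite_derclass: "finite (derclass n)"
  using bij_betw_finite[OF ZDer_bij[of n]] by simp

text \<open>\<open>f\<close> preserves length and \<open>Pos\<close>, so words with equal images
  share both; on a finite set injectivity then gives bijectivity.\<close>

lemma bij_betw_derclass:
  assumes "\<And>w. w \<in> derclass n \<Longrightarrow> length (f w) = length w \<and> Pos (f w) = Pos w"
    and "\<And>w w'. w \<in> derclass n \<Longrightarrow> length w' = length w \<Longrightarrow> Pos w' = Pos w \<Longrightarrow> f w = f w' \<Longrightarrow> w = w'"
  shows "bij_betw f (derclass n) (derclass n)"
proof -
  have "inj_on f (derclass n)"
  proof (rule inj_onI)
    fix w w' assume w: "w \<in> derclass n" "w' \<in> derclass n" "f w = f w'"
    have "length w' = length w" "Pos w' = Pos w"
      using assms(1)[OF w(1)] assms(1)[OF w(2)] w(3) by simp_all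
    then show "w = w'" using w(3) by (rule assms(2)[OF w(1)])
  qed
  moreover have "f ` derclass n \<subseteq> derclass n"
  proof (rule image_subsetI)
    fix w assume w: "w \<in> derclass n"
    from assms(1)[OF w] w show "f w \<in> derclass n" by (simp add: derclass_def)
  qed
  ultimately show ?thesis
    unfolding bij_betw_def by (intro conjI endo_inj_surj finite_derclass)
qed

lemma bPhi_bij: "bij_betw bPhi (derclass n) (derclass n)"
proof (rule bij_betw_derclass)
  fix w assume "w \<in> derclass n"
  then have der: "derword (Pos w)" by (simp add: derclass_def)
  show "length (bPhi w) = length w \<and> Pos (bPhi w) = Pos w"
    using bPhi_class[OF der] by blast
  show "w = w'" if "length w' = length w" "Pos w' = Pos w" "bPhi w = bPhi w'" for w'
    using der that by (rule bPhi_inj)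
qed

lemma bF3_bij: "bij_betw bF3 (derclass n) (derclass n)"
proof (rule bij_betw_derclass)
  fix w :: "nat list"
  show "length (bF3 w) = length w \<and> Pos (bF3 w) = Pos w" using bF3_class[of w] by blast
  show "w = w'" if "length w' = length w" "Pos w' = Pos w" "bF3 w = bF3 w'" for w'
    using that(1,2)[symmetric] that(3) by (rule bF3_inj)
qed

lemma conjugate_bij:
  assumes "bij_betw f (derclass n) (derclass n)"
  shows "bij_betw (\<lambda>s. the_inv_into (Sn n) ZDer (f (ZDer s))) (Sn n) (Sn n)"
  using bij_betw_trans[OF bij_betw_trans[OF ZDer_bij assms] bij_betw_the_inv_into[OF ZDer_bij]]
  unfolding comp_def .

lemma ZDer_conjugate:
  assumes "bij_betw f (derclass n) (derclass n)" "s \<in> Sn n"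
  shows "ZDer (the_inv_into (Sn n) ZDer (f (ZDer s))) = f (ZDer s)"
proof -
  have "f (ZDer s) \<in> derclass n"
    using bij_betw_apply[OF assms(1) ZDer_in_derclass[OF assms(2)]] .
  then show ?thesis by (intro f_the_inv_into_f_bij_betw[OF ZDer_bij]) simp
qed

text \<open>By the convention at infinity the descents are exactly the positions outside
  \<open>RISE\<close>.\<close>

lemma maj_eq_of_RISE_eq:
  assumes "length w = length w'" "RISE w = RISE w'"
  shows "maj w = maj w'"
proof -
  have "i \<in> DES v \<longleftrightarrow> i \<in> {1..length v} - RISE v" for i v
    unfolding DES_def RISE_def by (cases "1 \<le> i \<and> i < length v") auto
  then have "DES v = {1..length v} - RISE v" for v by blast
  with assms show ?thesis by (simp add: maj_def)
qed

theorem theorem1p4: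
  fixes n :: nat
  shows "bij_betw (PhiS n) (Sn n) (Sn n) \<and>
         bij_betw (F3S n) (Sn n) (Sn n) \<and>
         (\<forall>s\<in>Sn n. (fixpts s, RIZE s, Der s) =
                   (fixpts (PhiS n s), RISE (PhiS n s), Der (PhiS n s))) \<and>
         (\<forall>s\<in>Sn n. (fixpts s, int (maz s), Der s) =
                   (fixpts (F3S n s), maf (F3S n s), Der (F3S n s))) \<and>
         (\<forall>s\<in>Sn n. (fixpts s, int (maj s), Der s) =
                   (fixpts ((F3S n \<circ> the_inv_into (Sn n) (PhiS n)) s),
                    maf ((F3S n \<circ> the_inv_into (Sn n) (PhiS n)) s),
                    Der ((F3S n \<circ> the_inv_into (Sn n) (PhiS n)) s)))"
proof -
  have Phi: "bij_betw (PhiS n) (Sn n) (Sn n)"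
    using conjugate_bij[OF bPhi_bij] by (simp add: PhiS_def[abs_def])
  have F3: "bij_betw (F3S n) (Sn n) (Sn n)"
    using conjugate_bij[OF bF3_bij] by (simp add: F3S_def[abs_def])
  have fix_eq: "fixpts s = fixpts t" if "s \<in> Sn n" "t \<in> Sn n" "Der s = Der t" for s t
    using that by (simp add: fixpts_eq)
  have PhiE: "(fixpts s, RIZE s, Der s) = (fixpts (PhiS n s), RISE (PhiS n s), Der (PhiS n s))"
    if s: "s \<in> Sn n" for s
  proof -
    have t: "PhiS n s \<in> Sn n" using bij_betwE[OF Phi] s by blast
    have Z: "ZDer (PhiS n s) = bPhi (ZDer s)"
      unfolding PhiS_def by (rule ZDer_conjugate[OF bPhi_bij s])
    have der: "derword (Pos (ZDer s))" using ZDer_in_derclass[OF s] by (simp add: derclass_def)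
    have D: "Der s = Der (PhiS n s)" unfolding Der_def Z using bPhi_class(2)[OF der] by simp
    have "RISE (PhiS n s) = RIZE s"
      using RISE_key_ZDer[OF t] RISE_bPhi[OF der] unfolding Z RIZE_def by simp
    with fix_eq[OF s t D] D show ?thesis by simp
  qed
  have F3E: "(fixpts s, int (maz s), Der s) = (fixpts (F3S n s), maf (F3S n s), Der (F3S n s))"
    if s: "s \<in> Sn n" for s
  proof -
    have t: "F3S n s \<in> Sn n" using bij_betwE[OF F3] s by blast
    have Z: "ZDer (F3S n s) = bF3 (ZDer s)"
      unfolding F3S_def by (rule ZDer_conjugate[OF bF3_bij s])
    have D: "Der s = Der (F3S n s)" unfolding Der_def Z using bF3_class[of "ZDer s"] by simp
    have "maf (F3S n s) = int (maz s)" unfolding maf_def maz_def Z by (rule mafz_bF3)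
    with fix_eq[OF s t D] D show ?thesis by simp
  qed
  have "(fixpts s, int (maj s), Der s) = (fixpts (F3S n t), maf (F3S n t), Der (F3S n t))"
    if s: "s \<in> Sn n" and t: "t = the_inv_into (Sn n) (PhiS n) s" for s t
  proof -
    have tS: "t \<in> Sn n" unfolding t using bij_betwE[OF bij_betw_the_inv_into[OF Phi]] s by blast
    have st: "PhiS n t = s" unfolding t by (rule f_the_inv_into_f_bij_betw[OF Phi]) (use s in simp)
    \<comment> \<open>\<open>RISE s\<close> equals \<open>RIZE t\<close> by the first identity; the
      second identity, applied to \<open>t\<close>, then finishes.\<close>
    have "maj s = maz t"
      unfolding maz_def using PhiE[OF tS] SnD(1)[OF s] SnD(1)[OF tS]
      by (intro maj_eq_of_RISE_eq) (simp_all add: st RIZE_def)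
    with PhiE[OF tS] F3E[OF tS] show ?thesis by (simp add: st)
  qed
  with Phi F3 PhiE F3E show ?thesis by simp
qed

end
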